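(* Let $W_1,W_2,\dots$ be i.i.d. $\mathcal{W}$-valued random variables with common law $\lambda_0\in\mathcal{P}(\mathcal{W})$. For each $n$, let $\hat x^n_i:\mathcal{W}^n\to\mathcal{X}$, $i=1,\dots,n$, be measurable functions such that $(\hat x^n_1(\vec w),\dots,\hat x^n_n(\vec w))$ is a Nash equilibrium with type vector $\vec w$ for every $\vec w\in\mathcal{W}^n$, put $X^n_i=\hat x^n_i(W_1,\dots,W_n)$ and $\mu_n=\frac1n\sum_{i=1}^n\delta_{(W_i,X^n_i)}$. Then for any metric $d$ on $\mathcal{P}(\mathcal{W}\times\mathcal{X})$ compatible with weak convergence, almost surely $d(\mu_n,\mathcal{M}(\lambda_0)):=\inf_{m\in\mathcal{M}(\lambda_0)}d(\mu_n,m)\to0$ as $n\to\infty$.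
   Context: Standing assumptions: $\mathcal{X}$ is a compact metric space (action space) and $\mathcal{W}$ is a complete separable metric space (type space). For a metric space $S$, $\mathcal{P}(S)$ is the set of Borel probability measures on $S$ with the topology of weak convergence. $\mathcal{C}$ assigns to each $w\in\mathcal{W}$ a nonempty closed set $\mathcal{C}(w)\subset\mathcal{X}$; it is continuous in the sense that its graph $\mathrm{Gr}(\mathcal{C})=\{(w,x):x\in\mathcal{C}(w)\}$ is closed and, whenever $w_n\to w$ and $x\in\mathcal{C}(w)$, there exist $n_k$ and $x_{n_k}\in\mathcal{C}(w_{n_k})$ with $x_{n_k}\to x$. $F:\mathcal{P}(\mathcal{W}\times\mathcal{X})\times\mathcal{W}\times\mathcal{X}\to\mathbb{R}$ is bounded and continuous for the product topology. For $\vec w=(w_1,\dots,w_n)\in\mathcal{W}^n$, a Nash equilibrium with type vector $\vec w$ is a vector $(x_1,\dots,x_n)\in\mathcal{X}^n$ with $x_i\in\mathcal{C}(w_i)$ and $F(\frac1n\sum_k\delta_{(w_k,x_k)},w_i,x_i)=\inf_{y\in\mathcal{C}(w_i)}F(\frac1n\sum_{k\ne i}\delta_{(w_k,x_k)}+\frac1n\delta_{(w_i,y)},w_i,y)$ for each $i$. It is assumed that for every $n$ and every $\vec w\in\mathcal{W}^n$ a Nash equilibrium with type vector $\vec w$ exists. For $m\in\mathcal{P}(\mathcal{W}\times\mathcal{X})$, $m^w$ denotes its first marginal. For $\lambda\in\mathcal{P}(\mathcal{W})$, the set $\mathcal{M}(\lambda)$ of Cournot-Nash equilibria with type distribution $\lambda$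 is the set of $m\in\mathcal{P}(\mathcal{W}\times\mathcal{X})$ with $m^w=\lambda$ such that for $m$-a.e. $(w,x)$: $x\in\mathcal{C}(w)$ and $F(m,w,x)=\inf_{y\in\mathcal{C}(w)}F(m,w,y)$. *)

theory Defs
  imports "HOL-Probability.Probability"
begin

definition Prob :: "'a::topological_space measure set" where
  "Prob = {m. sets m = sets borel \<and> prob_space m}"

definition weak_top :: "'a::topological_space measure topology" where
  "weak_top = topology_generated_by
     {{m \<in> Prob. integral\<^sup>L m f \<in> U} | (f :: 'a \<Rightarrow> real) U.
        continuous_on UNIV f \<and> bounded (range f) \<and> open U}"

definition empirical :: "nat \<Rightarrow> (nat \<Rightarrow> 'a::topological_space) \<Rightarrow> 'a measure" where
  "empirical n p = distr (uniform_count_measure {..<n}) borel p"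

definition continuous_corr :: "('w::metric_space \<Rightarrow> 'x::metric_space set) \<Rightarrow> bool" where
  "continuous_corr C \<longleftrightarrow>
     closed {(w, x). x \<in> C w} \<and>
     (\<forall>ws w x. ws \<longlonglongrightarrow> w \<longrightarrow> x \<in> C w \<longrightarrow>
        (\<exists>r xs. strict_mono r \<and> (\<forall>k. xs k \<in> C (ws (r k))) \<and> xs \<longlonglongrightarrow> x))"

definition nash ::
  "(('w::topological_space \<times> 'x::topological_space) measure \<Rightarrow> 'w \<Rightarrow> 'x \<Rightarrow> real)
   \<Rightarrow> ('w \<Rightarrow> 'x set) \<Rightarrow> nat \<Rightarrow> (nat \<Rightarrow> 'w) \<Rightarrow> (nat \<Rightarrow> 'x) \<Rightarrow> bool" where
  "nash F C n w x \<longleftrightarrow>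
     (\<forall>i<n. x i \<in> C (w i) \<and>
        F (empirical n (\<lambda>k. (w k, x k))) (w i) (x i) =
        (INF y\<in>C (w i). F (empirical n (\<lambda>k. (w k, (x(i := y)) k))) (w i) y))"

definition CN ::
  "(('w::topological_space \<times> 'x::topological_space) measure \<Rightarrow> 'w \<Rightarrow> 'x \<Rightarrow> real)
   \<Rightarrow> ('w \<Rightarrow> 'x set) \<Rightarrow> 'w measure \<Rightarrow> ('w \<times> 'x) measure set" where
  "CN F C lam = {m \<in> Prob. distr m borel fst = lam \<and>
      (AE p in m. snd p \<in> C (fst p) \<and>
         F m (fst p) (snd p) = (INF y\<in>C (fst p). F m (fst p) y))}"

definition compatible_metric :: "('a::topological_space measure \<Rightarrow> 'a measure \<Rightarrow> real) \<Rightarrow> bool" where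
  "compatible_metric d \<longleftrightarrow>
     (\<forall>m\<in>Prob. \<forall>m'\<in>Prob. 0 \<le> d m m' \<and> d m m' = d m' m \<and> (d m m' = 0 \<longleftrightarrow> m = m')) \<and>
     (\<forall>m1\<in>Prob. \<forall>m2\<in>Prob. \<forall>m3\<in>Prob. d m1 m3 \<le> d m1 m2 + d m2 m3) \<and>
     (\<forall>U. openin weak_top U \<longleftrightarrow>
        (U \<subseteq> Prob \<and> (\<forall>m\<in>U. \<exists>e>0. \<forall>m'\<in>Prob. d m m' < e \<longrightarrow> m' \<in> U)))"

end

theory Submission
  imports Defs
begin

text \<open>
  Fix a sample point and suppose the distance to the equilibrium set stays away from zero along a
  subsequence. By the strong law of large numbers, applied to a countable family of continuous bump
  functions, the type marginals of the \<open>\<mu>\<^sub>n\<close> are almost surely tight and have \<open>\<lambda>\<^sub>0\<close> as only possible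
  limit. As the action space is compact, the \<open>\<mu>\<^sub>n\<close> are tight and a further subsequence converges
  weakly to some \<open>m\<close> with first marginal \<open>\<lambda>\<^sub>0\<close>.

  The limit \<open>m\<close> is an equilibrium: each point \<open>(w, x)\<close> of its support is a limit of type-action pairs
  of players in the finite games. By the continuity of \<open>C\<close>, every alternative \<open>y \<in> C w\<close> is a limit of
  admissible deviations of these players along a subsequence. Changing one player moves the empirical
  measure by \<open>O(1/n)\<close>, so the Nash inequalities pass to the limit by continuity of \<open>F\<close>.
\<close>

section \<open>Weak convergence and empirical measures\<close>

text \<open>The convergent subsequence depends on the sample point, so the exceptional null set must
  be fixed before any subsequence is taken; this is what forces a countable family of test
  functions. The family has two jobs: its integrals must determine a measure, and their convergence
  must yield tightness. Sums of cones over balls with centres in a dense sequence, amplified and cut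
  off at 1, do both, because suitable sequences of them converge to the indicator of any open set.
  Tightness is formulated with finitely many balls of each radius rather than with compact sets: it
  can be read off a single bump function, and it passes to the product with the compact action space
  by means of a finite net.

  The infimum is taken in the extended reals, where it is infinite over the empty set. The
  convergence thus contains the existence of an equilibrium with type distribution
  \<open>lam0\<close>, and the limit \<open>m\<close> is what supplies it.\<close>

lemma topspace_weak_top: "topspace (weak_top :: 'a::topological_space measure topology) = Prob"
proof -
  have "Prob \<in> {{m \<in> Prob. integral\<^sup>L m f \<in> U} | (f :: 'a \<Rightarrow> real) U.
        continuous_on UNIV f \<and> bounded (range f) \<and> open U}"
    by (intro CollectI exI[of _ "\<lambda>_. 0::real"] exI[of _ UNIV]) (auto simp: image_constant_conv)
  then show ?thesis
    unfolding weak_top_def topology_generated_by_topspace by blast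
qed

text \<open>Induction over the generated topology: subbasic sets are preimages of open sets of reals
  under integration, and eventual membership survives finite intersections and unions.\<close>

lemma limitin_weak_topI:
  fixes \<mu> :: "nat \<Rightarrow> 'a::topological_space measure"
  assumes m: "m \<in> Prob" and \<mu>: "\<And>n. \<mu> n \<in> Prob"
    and lim: "\<And>f :: 'a \<Rightarrow> real. continuous_on UNIV f \<Longrightarrow> bounded (range f) \<Longrightarrow>
                (\<lambda>n. integral\<^sup>L (\<mu> n) f) \<longlonglongrightarrow> integral\<^sup>L m f"
  shows "limitin weak_top \<mu> m sequentially"
  unfolding limitin_def topspace_weak_top
proof (intro conjI allI impI)
  show "m \<in> Prob" by fact
  fix U assume "openin weak_top U \<and> m \<in> U"
  then have "generate_topology_on {{m \<in> Prob. integral\<^sup>L m f \<in> U} | (f :: 'a \<Rightarrow> real) U.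
        continuous_on UNIV f \<and> bounded (range f) \<and> open U} U" and "m \<in> U"
    by (auto simp: weak_top_def openin_topology_generated_by_iff)
  then show "\<forall>\<^sub>F n in sequentially. \<mu> n \<in> U"
  proof induction
    case (Int a b)
    then show ?case by (auto simp: eventually_conj_iff)
  next
    case (UN K)
    then obtain k where "k \<in> K" "m \<in> k" by auto
    with UN have "\<forall>\<^sub>F n in sequentially. \<mu> n \<in> k" by blast
    then show ?case by eventually_elim (use \<open>k \<in> K\<close> in auto)
  next
    case (Basis s)
    then obtain f :: "'a \<Rightarrow> real" and V where s: "s = {m \<in> Prob. integral\<^sup>L m f \<in> V}"
      and f: "continuous_on UNIV f" "bounded (range f)" and "open V" by blast
    then have "\<forall>\<^sub>F n in sequentially. integral\<^sup>L (\<mu> n) f \<in> V"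
      using topological_tendstoD[OF lim[OF f] \<open>open V\<close>] Basis by auto
    then show ?case by (simp add: s \<mu>)
  qed simp
qed

lemma sets_empirical [simp, measurable_cong]: "sets (empirical n p) = sets borel"
  by (simp add: empirical_def)

lemma empirical_Prob:
  assumes "n > 0"
  shows "empirical n p \<in> Prob"
proof -
  interpret prob_space "uniform_count_measure {..<n}"
    using assms by (intro prob_space_uniform_count_measure) auto
  have "prob_space (empirical n p)"
    unfolding empirical_def
    by (rule prob_space_distr) (simp add: measurable_def space_uniform_count_measure sets_uniform_count_measure)
  then show ?thesis by (simp add: Prob_def)
qed

lemma integral_empirical:
  fixes f :: "'a::topological_space \<Rightarrow> real"
  assumes "f \<in> borel_measurable borel"
  shows "integral\<^sup>L (empirical n p) f = (\<Sum>i<n. f (p i)) / n"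
  unfolding empirical_def using assms
  by (subst integral_distr)
     (auto simp: measurable_def space_uniform_count_measure sets_uniform_count_measure
                 integral_uniform_count_measure)

text \<open>Replaces a diagonal argument: the cube is compact by Tychonoff, and over a countable
  index type the product topology is first countable, so compactness gives sequential
  compactness.\<close>

lemma convergent_subsequence_countable:
  fixes q :: "nat \<Rightarrow> 'i::countable \<Rightarrow> real"
  assumes q: "\<And>n i. q n i \<in> {a..b}"
  obtains r p where "strict_mono r" "\<And>i. (\<lambda>n. q (r n) i) \<longlonglongrightarrow> p i"
proof -
  have "compactin (product_topology (\<lambda>_. euclideanreal) (UNIV :: 'i set)) (PiE UNIV (\<lambda>_. {a..b}))"
    by (simp add: compactin_PiE)
  then have "compact (PiE (UNIV :: 'i set) (\<lambda>_. {a..b}))"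
    by (simp add: euclidean_product_topology)
  then have "seq_compact (PiE (UNIV :: 'i set) (\<lambda>_. {a..b}))"
    by (rule compact_imp_seq_compact)
  moreover have "q n \<in> PiE UNIV (\<lambda>_. {a..b})" for n
    using q by auto
  ultimately obtain p r where "strict_mono r" and lim: "(q \<circ> r) \<longlonglongrightarrow> p"
    unfolding seq_compact_def by metis
  have "(\<lambda>n. q (r n) i) \<longlonglongrightarrow> p i" for i
    using continuous_on_tendsto_compose[OF continuous_on_product_coordinates[of i] lim]
    by (simp add: o_def)
  with \<open>strict_mono r\<close> show thesis using that by blast
qed

text \<open>For values in an interval of length 1, Hoeffding's inequality bounds the deviation
  probabilities by a geometric sequence. Borel-Cantelli then excludes deviations of size \<epsilon>
  infinitely often, and countably many \<epsilon> suffice.\<close>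

lemma (in prob_space) slln_bounded:
  fixes W :: "nat \<Rightarrow> 'a \<Rightarrow> 'w::topological_space" and f :: "'w \<Rightarrow> real"
  assumes W_meas: "\<And>i. W i \<in> measurable M borel"
    and indep: "indep_vars (\<lambda>_. borel) W UNIV"
    and law: "\<And>i. distr M borel (W i) = L"
    and f [measurable]: "f \<in> borel_measurable borel"
    and bound: "\<And>w. f w \<in> {0..1}"
  shows "AE \<omega> in M. (\<lambda>n. (\<Sum>i<n. f (W i \<omega>)) / n) \<longlonglongrightarrow> integral\<^sup>L L f"
proof -
  note [measurable] = W_meas
  define mu where "mu = integral\<^sup>L L f"
  define S where "S n \<omega> = (\<Sum>i<n. f (W i \<omega>)) / n" for n \<omega>
  have S [measurable]: "S n \<in> borel_measurable M" for n
    unfolding S_def by measurable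
  have ev: "AE \<omega> in M. \<forall>\<^sub>F n in sequentially. \<bar>S n \<omega> - mu\<bar> < \<epsilon>" if \<epsilon>: "\<epsilon> > 0" for \<epsilon>
  proof -
    define A where "A n = {\<omega>\<in>space M. \<bar>S n \<omega> - mu\<bar> \<ge> \<epsilon>}" for n
    have hoeff: "prob (A n) \<le> 2 * exp (-2 * \<epsilon>\<^sup>2) ^ n" if "n > 0" for n
    proof -
      interpret Hoeffding_ineq_iid M "{..<n}" "\<lambda>i \<omega>. f (W i \<omega>)" "\<lambda>\<omega>. f (W 0 \<omega>)" 0 1 mu
      proof (unfold_locales; (intro AE_I2)?)
        show "indep_vars (\<lambda>_. borel) (\<lambda>i \<omega>. f (W i \<omega>)) {..<n}"
          by (rule indep_vars_compose2[OF indep_vars_subset[OF indep]]) auto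
        show "distr M borel (\<lambda>\<omega>. f (W i \<omega>)) = distr M borel (\<lambda>\<omega>. f (W 0 \<omega>))" for i
        proof -
          have "distr M borel (\<lambda>\<omega>. f (W j \<omega>)) = distr L borel f" for j
            unfolding law[of j, symmetric] by (subst distr_distr) (auto simp: o_def)
          then show ?thesis by simp
        qed
        show "mu \<equiv> expectation (\<lambda>\<omega>. f (W 0 \<omega>))"
          unfolding mu_def law[of 0, symmetric] by (subst integral_distr) auto
      qed (use bound in auto)
      have "prob (A n) \<le> 2 * exp (-2 * real n * \<epsilon>\<^sup>2)"
        using Hoeffding_ineq_abs_ge'[of \<epsilon>] \<epsilon> that unfolding A_def S_def by auto
      also have "exp (-2 * real n * \<epsilon>\<^sup>2) = exp (-2 * \<epsilon>\<^sup>2) ^ n"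
        by (simp add: exp_of_nat_mult[symmetric] algebra_simps)
      finally show ?thesis .
    qed
    have "summable (\<lambda>n. 2 * exp (-2 * \<epsilon>\<^sup>2) ^ n)"
      using \<epsilon> by (intro summable_mult summable_geometric) auto
    then have "summable (\<lambda>n. prob (A n))"
      by (rule summable_comparison_test_ev[rotated])
         (use hoeff in \<open>auto intro!: eventually_sequentiallyI[of 1]\<close>)
    then have "AE \<omega> in M. \<forall>\<^sub>F n in sequentially. \<omega> \<in> space M - A n"
      by (intro borel_cantelli_AE1) (auto simp: A_def emeasure_eq_measure)
    then show ?thesis
      by eventually_elim (auto simp: A_def elim!: eventually_mono)
  qed
  have "AE \<omega> in M. \<forall>k. \<forall>\<^sub>F n in sequentially. \<bar>S n \<omega> - mu\<bar> < 1 / Suc k"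
    by (subst AE_all_countable) (auto intro: ev)
  then show ?thesis
  proof eventually_elim
    case (elim \<omega>)
    have "(\<lambda>n. S n \<omega>) \<longlonglongrightarrow> mu"
    proof (rule tendstoI)
      fix e :: real assume "e > 0"
      then obtain k where "1 / Suc k < e" using nat_approx_posE by blast
      with elim[rule_format, of k] show "\<forall>\<^sub>F n in sequentially. dist (S n \<omega>) mu < e"
        by (auto simp: dist_real_def elim!: eventually_mono)
    qed
    then show ?case by (simp add: S_def mu_def)
  qed
qed

section \<open>Sequential Prokhorov theorem\<close>

text \<open>Half-open, so that the code intervals of any fixed length partition it with no endpoint
  left over.\<close>

definition unit_lebesgue :: "real measure" where
  "unit_lebesgue = restrict_space lborel {0..<1}"

lemma space_unit_lebesgue [simp]: "space unit_lebesgue = {0..<1}"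
  by (simp add: unit_lebesgue_def space_restrict_space)

lemma prob_space_unit_lebesgue: "prob_space unit_lebesgue"
  by (rule prob_spaceI) (simp add: unit_lebesgue_def emeasure_restrict_space space_restrict_space)

text \<open>
  The weights split \<open>[0,1)\<close> into nested half-open intervals, one for each list, the interval of
  \<open>s\<close> having length \<open>p s\<close>. Lists grow at the head, so \<open>j # s\<close> is a child of \<open>s\<close>. The value
  \<open>interval_code p k u\<close> is the list of length \<open>k\<close> whose interval contains \<open>u\<close>.
\<close>

primrec left_end :: "(nat list \<Rightarrow> real) \<Rightarrow> nat list \<Rightarrow> real" where
  "left_end p [] = 0"
| "left_end p (j # s) = left_end p s + (\<Sum>i<j. p (i # s))"

primrec interval_code :: "(nat list \<Rightarrow> real) \<Rightarrow> nat \<Rightarrow> real \<Rightarrow> nat list" where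
  "interval_code p 0 u = []"
| "interval_code p (Suc k) u =
     (LEAST j. u < left_end p (Suc j # interval_code p k u)) # interval_code p k u"

text \<open>These are the consistency conditions for the cylinder masses of a probability measure on
  infinite sequences of naturals. Coding by nested intervals realises that measure as the law of a
  random sequence on \<open>[0,1)\<close>, with Lebesgue measure as the source of
  randomness.\<close>

locale tree_weights =
  fixes p :: "nat list \<Rightarrow> real"
  assumes nonneg: "p s \<ge> 0"
    and root: "p [] = 1"
    and children_sums: "(\<lambda>j. p (j # s)) sums p s"
begin

abbreviation code_interval :: "nat list \<Rightarrow> real set" where
  "code_interval s \<equiv> {left_end p s..<left_end p s + p s}"

lemma left_end_Suc: "left_end p (Suc j # s) = left_end p (j # s) + p (j # s)"
  by simp

lemma left_end_mono: "i \<le> j \<Longrightarrow> left_end p (i # s) \<le> left_end p (j # s)"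
  by (simp add: sum_mono2 nonneg)

lemma left_end_le: "left_end p (j # s) \<le> left_end p s + p s"
  using sum_le_suminf[OF sums_summable[OF children_sums], of "{..<j}" s] sums_unique[OF children_sums, of s]
  by (simp add: nonneg)

lemma code_interval_Cons_subset: "code_interval (j # s) \<subseteq> code_interval s"
  using left_end_le[of "Suc j" s] sum_nonneg[of "{..<j}" "\<lambda>i. p (i # s)"]
  by (auto simp: nonneg)

lemma code_interval_subset: "code_interval s \<subseteq> {0..<1}"
proof (induction s)
  case (Cons j s)
  then show ?case using code_interval_Cons_subset[of j s] by (rule order_trans[rotated])
qed (simp add: root)

text \<open>The children carry the full mass of the parent, so their right ends come arbitrarily
  close to the right end of the parent interval. This guarantees that the \<open>LEAST\<close> in
  \<open>interval_code\<close> is attained.\<close>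

lemma ex_left_end_gt:
  assumes "u < left_end p s + p s"
  shows "\<exists>j. u < left_end p (Suc j # s)"
proof -
  have "(\<lambda>j. \<Sum>i<Suc j. p (i # s)) \<longlonglongrightarrow> p s"
    using children_sums[of s] unfolding sums_def by (rule LIMSEQ_Suc)
  then have "\<forall>\<^sub>F j in sequentially. u - left_end p s < (\<Sum>i<Suc j. p (i # s))"
    using assms by (intro order_tendstoD) auto
  then obtain j where "u - left_end p s < (\<Sum>i<Suc j. p (i # s))"
    by (auto simp: eventually_sequentially)
  then show ?thesis by (intro exI[of _ j]) (simp add: algebra_simps)
qed

lemma interval_code_eq_iff:
  assumes "u \<in> {0..<1}"
  shows "interval_code p (length s) u = s \<longleftrightarrow> u \<in> code_interval s"
proof (induction s)
  case Nil
  then show ?case using assms by (simp add: root)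
next
  case (Cons j s)
  show ?case
  proof (cases "interval_code p (length s) u = s")
    case False
    then show ?thesis using Cons code_interval_Cons_subset[of j s] by auto
  next
    case True
    then have u: "u \<in> code_interval s" using Cons by simp
    let ?Q = "\<lambda>j. u < left_end p (Suc j # s)"
    have ex: "\<exists>j. ?Q j" using u by (intro ex_left_end_gt) auto
    have "(LEAST j. ?Q j) = j \<longleftrightarrow> u \<in> code_interval (j # s)"
    proof
      assume L: "(LEAST j. ?Q j) = j"
      have "?Q j" using LeastI_ex[OF ex] L by simp
      moreover have "left_end p (j # s) \<le> u"
      \<comment> \<open>For \<open>j = 0\<close> the left ends of child and parent agree; otherwise
        the preceding index fails \<open>?Q\<close>, and its right end is the left end of
        \<open>j # s\<close>.\<close>
      proof (cases j)
        case 0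
        then show ?thesis using u by simp
      next
        case (Suc i)
        then show ?thesis using not_less_Least[of i ?Q] L by auto
      qed
      ultimately show "u \<in> code_interval (j # s)" by (simp add: left_end_Suc)
    next
      assume u': "u \<in> code_interval (j # s)"
      show "(LEAST j. ?Q j) = j"
      proof (rule Least_equality)
        show "?Q j" using u' by simp
        fix y assume y: "?Q y"
        show "j \<le> y"
        proof (rule ccontr)
          assume "\<not> j \<le> y"
          then have "left_end p (Suc y # s) \<le> left_end p (j # s)" by (intro left_end_mono) simp
          then show False using y u' by auto
        qed
      qed
    qed
    then show ?thesis using True by (simp del: left_end.simps)
  qed
qed

lemma length_interval_code [simp]: "length (interval_code p k u) = k"
  by (induction k) auto

lemma interval_code_vimage:
  "{u \<in> {0..<1}. interval_code p k u = s} = (if length s = k then code_interval s else {})"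
  using interval_code_eq_iff[of _ s] code_interval_subset[of s] by (auto split: if_splits)

lemma interval_code_measurable [measurable]:
  "interval_code p k \<in> measurable unit_lebesgue (count_space UNIV)"
proof (rule measurableI)
  fix A :: "nat list set"
  have "interval_code p k -` A \<inter> space unit_lebesgue
      = (\<Union>s\<in>A. {u \<in> {0..<1}. interval_code p k u = s})" by auto
  also have "\<dots> \<in> sets unit_lebesgue"
    unfolding interval_code_vimage
    using code_interval_subset
    by (intro sets.countable_UN') (auto simp: unit_lebesgue_def sets_restrict_space_iff)
  finally show "interval_code p k -` A \<inter> space unit_lebesgue \<in> sets unit_lebesgue" .
qed auto

lemma measure_interval_code:
  assumes "length s = k"
  shows "measure unit_lebesgue {u \<in> {0..<1}. interval_code p k u = s} = p s"
  unfolding interval_code_vimage using code_interval_subset[of s] assms nonneg[of s]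
  by (simp add: unit_lebesgue_def measure_restrict_space)

text \<open>A point lies in the interval of its own code, which therefore has positive length. This
  is used to see that the cells along a code are nonempty for every \<open>u\<close>, not merely for
  almost every one.\<close>

lemma interval_code_pos:
  assumes "u \<in> {0..<1}"
  shows "p (interval_code p k u) > 0"
  using interval_code_eq_iff[OF assms, of "interval_code p k u"] by auto

text \<open>Limits of cell masses can be exchanged with finite sums only, so the integral, a
  countable sum over codes, is truncated to the codes enumerated before some \<open>N\<close>.
  Dominated convergence makes the loss small enough to stay above \<open>c\<close>.\<close>

lemma integral_interval_code_approx:
  fixes g :: "nat list \<Rightarrow> real"
  assumes g: "\<And>s. \<bar>g s\<bar> \<le> B"
    and less: "c < (\<integral>u. g (interval_code p k u) \<partial>unit_lebesgue)"
  obtains A where "finite A" "\<And>s. s \<in> A \<Longrightarrow> length s = k" "c < (\<Sum>s\<in>A. g s * p s)"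
proof -
  interpret prob_space unit_lebesgue by (rule prob_space_unit_lebesgue)
  define A where "A N = {s :: nat list. to_nat s < N \<and> length s = k}" for N :: nat
  have fin: "finite (A N)" for N
    by (rule finite_subset[OF _ finite_vimageI[OF finite_lessThan[of N] inj_to_nat]]) (auto simp: A_def)
  have "(\<lambda>N. \<integral>u. (if interval_code p k u \<in> A N then g (interval_code p k u) else 0) \<partial>unit_lebesgue)
     \<longlonglongrightarrow> (\<integral>u. g (interval_code p k u) \<partial>unit_lebesgue)"
  proof (rule integral_dominated_convergence[where w = "\<lambda>_. B"]; (intro AE_I2)?)
    fix u
    have "\<forall>\<^sub>F N in sequentially. interval_code p k u \<in> A N"
      unfolding A_def using eventually_gt_at_top[of "to_nat (interval_code p k u)"]
      by eventually_elim auto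
    then have "\<forall>\<^sub>F N in sequentially.
        (if interval_code p k u \<in> A N then g (interval_code p k u) else 0) = g (interval_code p k u)"
      by eventually_elim simp
    then show "(\<lambda>N. if interval_code p k u \<in> A N then g (interval_code p k u) else 0)
        \<longlonglongrightarrow> g (interval_code p k u)"
      by (rule tendsto_eventually)
    show "norm (if interval_code p k u \<in> A N then g (interval_code p k u) else 0) \<le> B" for N
      using g[of "interval_code p k u"] by auto
  qed auto
  then have "\<forall>\<^sub>F N in sequentially.
      c < (\<integral>u. (if interval_code p k u \<in> A N then g (interval_code p k u) else 0) \<partial>unit_lebesgue)"
    using less by (rule order_tendstoD)
  then obtain N where
    N: "c < (\<integral>u. (if interval_code p k u \<in> A N then g (interval_code p k u) else 0) \<partial>unit_lebesgue)"
    by (auto simp: eventually_sequentially)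
  have "(\<integral>u. (if interval_code p k u \<in> A N then g (interval_code p k u) else 0) \<partial>unit_lebesgue)
      = (\<integral>u. (\<Sum>s\<in>A N. g s * indicator {u \<in> {0..<1}. interval_code p k u = s} u) \<partial>unit_lebesgue)"
    by (intro Bochner_Integration.integral_cong) (auto simp: indicator_def fin if_distrib cong: if_cong)
  also have "\<dots> = (\<Sum>s\<in>A N. g s * p s)"
  proof (subst Bochner_Integration.integral_sum)
    have m: "{u \<in> {0..<1}. interval_code p k u = s} \<in> events" for s
      by (subst space_unit_lebesgue[symmetric]) measurable
    show "integrable unit_lebesgue (\<lambda>u. g s * indicator {u \<in> {0..<1}. interval_code p k u = s} u)" for s
      using m by (intro integrable_mult_right integrable_real_indicator) (auto simp: emeasure_eq_measure)
    show "(\<Sum>s\<in>A N. \<integral>u. g s * indicator {u \<in> {0..<1}. interval_code p k u = s} u \<partial>unit_lebesgue)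
        = (\<Sum>s\<in>A N. g s * p s)"
    proof (intro sum.cong refl)
      fix s assume "s \<in> A N"
      moreover have "{u \<in> {0..<1}. interval_code p k u = s} \<inter> space unit_lebesgue
          = {u \<in> {0..<1}. interval_code p k u = s}" by auto
      ultimately show "(\<integral>u. g s * indicator {u \<in> {0..<1}. interval_code p k u = s} u \<partial>unit_lebesgue) = g s * p s"
        using measure_interval_code[of s k]
        by (simp only: integral_mult_right_zero Bochner_Integration.integral_indicator) (simp add: A_def)
    qed
  qed
  finally show thesis
    using N fin[of N] by (intro that[of "A N"]) (auto simp: A_def)
qed

end

section \<open>Nested Borel partitions of a separable metric space\<close>

locale dense_sequence =
  fixes e :: "nat \<Rightarrow> 'a::metric_space"
  assumes dense: "r > 0 \<Longrightarrow> \<exists>j. dist x (e j) < r"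
begin

text \<open>
  The cells of length \<open>k\<close> form a countable Borel partition refining the one of length \<open>k - 1\<close>; the
  head of a cell's list names a ball of radius \<open>2\<^sup>1\<^sup>-\<^sup>k\<close> containing it.
\<close>

definition nearest :: "nat \<Rightarrow> 'a \<Rightarrow> nat" where
  "nearest k x = (LEAST j. dist x (e j) < (1/2) ^ k)"

definition code :: "nat \<Rightarrow> 'a \<Rightarrow> nat list" where
  "code k x = rev (map (\<lambda>i. nearest i x) [0..<k])"

definition cell :: "nat list \<Rightarrow> 'a set" where
  "cell s = {x. code (length s) x = s}"

lemma dist_nearest: "dist x (e (nearest k x)) < (1/2) ^ k"
  unfolding nearest_def by (rule LeastI_ex[OF dense]) simp

lemma nearest_le: "dist x (e j) < (1/2) ^ k \<Longrightarrow> nearest k x \<le> j"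
  unfolding nearest_def by (rule Least_le)

lemma length_code [simp]: "length (code k x) = k"
  by (simp add: code_def)

lemma code_Suc: "code (Suc k) x = nearest k x # code k x"
  by (simp add: code_def)

lemma cell_Nil: "cell [] = UNIV"
  by (simp add: cell_def code_def)

lemma cell_Cons: "cell (j # s) = {x \<in> cell s. nearest (length s) x = j}"
  by (auto simp: cell_def code_Suc)

text \<open>The usual disjointification of a countable cover by balls, which makes the cells
  Borel.\<close>

lemma nearest_eq: "{x. nearest k x = j} = ball (e j) ((1/2) ^ k) - (\<Union>i<j. ball (e i) ((1/2) ^ k))"
proof -
  have "nearest k x = j \<longleftrightarrow> dist x (e j) < (1/2) ^ k \<and> (\<forall>i<j. \<not> dist x (e i) < (1/2) ^ k)" for x
    using dist_nearest[of x k] nearest_le[of x _ k]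
    by (metis linorder_neqE_nat not_less)
  then show ?thesis by (auto simp: dist_commute)
qed

lemma nearest_ge: "{x. J \<le> nearest k x} = - (\<Union>j<J. ball (e j) ((1/2) ^ k))"
proof -
  have "J \<le> nearest k x \<longleftrightarrow> (\<forall>j<J. \<not> dist x (e j) < (1/2) ^ k)" for x
    using dist_nearest[of x k] nearest_le[of x _ k]
    by (metis le_less_linear order_less_le_trans order_less_irrefl)
  then show ?thesis by (auto simp: dist_commute)
qed

lemma cell_borel [measurable]: "cell s \<in> sets borel"
proof (induction s)
  case (Cons j s)
  have "cell (j # s) = cell s \<inter> {x. nearest (length s) x = j}"
    by (auto simp: cell_Cons)
  also have "\<dots> \<in> sets borel"
    unfolding nearest_eq by (intro sets.Int Cons sets.Diff borel_open open_UN) auto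
  finally show ?case .
qed (simp add: cell_Nil)

lemma nearest_ge_borel [measurable]: "{x. J \<le> nearest k x} \<in> sets borel"
  unfolding nearest_ge by (intro borel_comp borel_open) auto

lemma cell_dist: "x \<in> cell (j # s) \<Longrightarrow> dist x (e j) < (1/2) ^ length s"
  using dist_nearest[of x "length s"] by (auto simp: cell_Cons)

text \<open>What the first \<open>J\<close> children miss lies in a tail set that depends on
  \<open>s\<close> only through its length. Both bounds involve finite sums and so survive the
  passage to limiting masses, while tightness controls the tail uniformly.\<close>

lemma cell_mass_split:
  assumes "m \<in> Prob"
  shows "(\<Sum>j<J. measure m (cell (j # s))) \<le> measure m (cell s)"
    and "measure m (cell s) \<le> (\<Sum>j<J. measure m (cell (j # s))) + measure m {x. J \<le> nearest (length s) x}"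
proof -
  interpret prob_space m using assms by (simp add: Prob_def)
  have [simp]: "events = sets borel" using assms by (simp add: Prob_def)
  have eq: "(\<Sum>j<J. prob (cell (j # s))) = prob (\<Union>j<J. cell (j # s))"
  proof (rule finite_measure_finite_Union[symmetric])
    show "disjoint_family_on (\<lambda>j. cell (j # s)) {..<J}"
      by (auto simp: disjoint_family_on_def cell_Cons)
  qed auto
  show "(\<Sum>j<J. prob (cell (j # s))) \<le> prob (cell s)"
    unfolding eq by (rule finite_measure_mono) (auto simp: cell_Cons)
  have "prob (cell s) \<le> prob ((\<Union>j<J. cell (j # s)) \<union> {x. J \<le> nearest (length s) x})"
  proof (rule finite_measure_mono)
    show "cell s \<subseteq> (\<Union>j<J. cell (j # s)) \<union> {x. J \<le> nearest (length s) x}"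
      by (auto simp: cell_Cons not_le)
  qed auto
  also have "\<dots> \<le> prob (\<Union>j<J. cell (j # s)) + prob {x. J \<le> nearest (length s) x}"
    by (rule measure_Un_le) auto
  finally show "prob (cell s) \<le> (\<Sum>j<J. prob (cell (j # s))) + prob {x. J \<le> nearest (length s) x}"
    by (simp add: eq)
qed

text \<open>A point within \<open>(1/2) ^ Suc k\<close> of a centre \<open>x\<close> is within
  \<open>(1/2) ^ k\<close> of the dense point chosen for \<open>x\<close> at level
  \<open>Suc k\<close>. Its index at level \<open>k\<close> is thus bounded by that of
  \<open>x\<close> at level \<open>Suc k\<close>, and there are finitely many centres.\<close>

lemma nearest_tight:
  fixes \<mu> :: "nat \<Rightarrow> 'a measure"
  assumes \<mu>: "\<And>n. \<mu> n \<in> Prob" and S: "finite S"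
    and mass: "\<forall>\<^sub>F n in sequentially. 1 - \<epsilon> \<le> measure (\<mu> n) (\<Union>x\<in>S. ball x ((1/2) ^ Suc k))"
  obtains J0 where "\<And>J. J \<ge> J0 \<Longrightarrow> \<forall>\<^sub>F n in sequentially. measure (\<mu> n) {x. J \<le> nearest k x} \<le> \<epsilon>"
proof -
  \<comment> \<open>\<open>insert 0\<close> keeps the maximum meaningful for empty \<open>S\<close>;
    \<open>Suc\<close> makes the bound strict.\<close>
  define J0 where "J0 = Suc (Max (insert 0 (nearest (Suc k) ` S)))"
  have "\<forall>\<^sub>F n in sequentially. measure (\<mu> n) {x. J \<le> nearest k x} \<le> \<epsilon>" if "J \<ge> J0" for J
    using mass
  proof eventually_elim
    case (elim n)
    interpret prob_space "\<mu> n" using \<mu>[of n] by (simp add: Prob_def)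
    have [simp]: "events = sets borel" using \<mu>[of n] by (simp add: Prob_def)
    then have [simp]: "space (\<mu> n) = UNIV" by (metis sets_eq_imp_space_eq space_borel)
    have disj: "{x. J \<le> nearest k x} \<subseteq> UNIV - (\<Union>x\<in>S. ball x ((1/2) ^ Suc k))"
    proof (intro subsetI DiffI UNIV_I notI; elim UN_E; unfold mem_Collect_eq)
      fix y x assume y: "J \<le> nearest k y" and x: "x \<in> S" "y \<in> ball x ((1/2) ^ Suc k)"
      have "dist y (e (nearest (Suc k) x)) \<le> dist x y + dist x (e (nearest (Suc k) x))"
        by (rule dist_triangle3)
      also have "\<dots> < (1/2) ^ Suc k + (1/2) ^ Suc k"
        using x dist_nearest[of x "Suc k"] by (intro add_strict_mono) auto
      also have "\<dots> = (1/2) ^ k" by simp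
      finally have "nearest k y \<le> nearest (Suc k) x" by (rule nearest_le)
      also have "\<dots> < J0" unfolding J0_def less_Suc_eq_le using x S by (intro Max_ge) auto
      finally show False using y that by simp
    qed
    have "prob {x. J \<le> nearest k x} \<le> prob (space (\<mu> n) - (\<Union>x\<in>S. ball x ((1/2) ^ Suc k)))"
      using disj S by (intro finite_measure_mono) (auto intro!: sets.Diff sets.finite_UN)
    also have "\<dots> = 1 - prob (\<Union>x\<in>S. ball x ((1/2) ^ Suc k))"
      using S by (intro prob_compl) (auto intro!: sets.finite_UN)
    finally show ?case using elim by simp
  qed
  then show thesis by (rule that)
qed

text \<open>Cells of equal length are disjoint, so at each point at most one summand is nonzero;
  outside the cells of \<open>A\<close> the bound is the nonnegativity of \<open>f\<close>.\<close>

lemma sum_inf_cell_le_integral: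
  fixes f :: "'a \<Rightarrow> real"
  assumes m: "m \<in> Prob" and f: "f \<in> borel_measurable borel" "\<And>x. 0 \<le> f x" "\<And>x. f x \<le> B"
    and A: "finite A" "\<And>s. s \<in> A \<Longrightarrow> length s = k"
    and g: "\<And>s x. x \<in> cell s \<Longrightarrow> g s \<le> f x"
  shows "(\<Sum>s\<in>A. g s * measure m (cell s)) \<le> integral\<^sup>L m f"
proof -
  interpret prob_space m using m by (simp add: Prob_def)
  have s [simp]: "events = sets borel" using m by (simp add: Prob_def)
  then have [simp]: "space m = UNIV" by (metis sets_eq_imp_space_eq space_borel)
  have [measurable]: "f \<in> borel_measurable m" using f(1) by (simp cong: measurable_cong_sets)
  have int: "integrable m (\<lambda>x. g s * indicator (cell s) x)" for s
    by (intro integrable_mult_right integrable_real_indicator) (auto simp: emeasure_eq_measure)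
  have "(\<Sum>s\<in>A. g s * prob (cell s)) = (\<integral>x. (\<Sum>s\<in>A. g s * indicator (cell s) x) \<partial>m)"
    using int by (subst Bochner_Integration.integral_sum) auto
  also have "\<dots> \<le> integral\<^sup>L m f"
  proof (rule integral_mono)
    show "integrable m (\<lambda>x. \<Sum>s\<in>A. g s * indicator (cell s) x)" using int by auto
    show "integrable m f" using f by (intro integrable_const_bound[where B = B]) auto
    fix x
    have "(\<Sum>s\<in>A. g s * indicator (cell s) x) = (\<Sum>s\<in>A. if s = code k x then g s else 0)"
      using A(2) by (intro sum.cong) (auto simp: cell_def indicator_def)
    also have "\<dots> \<le> f x"
      using g[of x "code k x"] f(2) A(1) by (auto simp: cell_def)
    finally show "(\<Sum>s\<in>A. g s * indicator (cell s) x) \<le> f x" .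
  qed
  finally show ?thesis .
qed

end

text \<open>
  Along a subsequence the masses of all cells converge, and tightness makes the limits additive. They
  are then realised as lengths of nested intervals, and the limit measure is the law of the map \<open>Z\<close>
  sending \<open>u\<close> to the point onto which the cells coded by \<open>u\<close> shrink. No mass is lost since \<open>Z\<close>
  exists everywhere, and approximating a continuous function from below by its cellwise infima yields
  weak convergence.
\<close>

theorem prokhorov_sequential:
  fixes \<mu> :: "nat \<Rightarrow> 'a::metric_space measure" and D :: "'a set"
  assumes complete: "\<And>X :: nat \<Rightarrow> 'a. Cauchy X \<Longrightarrow> convergent X"
    and D: "countable D" "\<And>x r. r > 0 \<Longrightarrow> \<exists>y\<in>D. dist x y < r"
    and \<mu>: "\<And>n. \<mu> n \<in> Prob"
    and tight: "\<And>r \<epsilon>. r > 0 \<Longrightarrow> \<epsilon> > 0 \<Longrightarrow>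
       \<exists>S. finite S \<and> (\<forall>\<^sub>F n in sequentially. 1 - \<epsilon> \<le> measure (\<mu> n) (\<Union>x\<in>S. ball x r))"
  obtains r m where "strict_mono r" "m \<in> Prob"
    "\<And>f :: 'a \<Rightarrow> real. continuous_on UNIV f \<Longrightarrow> bounded (range f) \<Longrightarrow>
        (\<lambda>n. integral\<^sup>L (\<mu> (r n)) f) \<longlonglongrightarrow> integral\<^sup>L m f"
proof -
  have "D \<noteq> {}" using D(2)[of 1] by force
  interpret dense_sequence "from_nat_into D"
  proof
    fix x :: 'a and r :: real assume "r > 0"
    with D obtain y where "y \<in> D" "dist x y < r" by blast
    with from_nat_into_surj[OF D(1)] show "\<exists>j. dist x (from_nat_into D j) < r" by metis
  qed
  define e where "e = from_nat_into D"
  have prob: "prob_space (\<mu> n)" and sets_\<mu>: "sets (\<mu> n) = sets borel" for n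
    using \<mu>[of n] by (auto simp: Prob_def)
  have space_\<mu>: "space (\<mu> n) = UNIV" for n
    using sets_eq_imp_space_eq[OF sets_\<mu>[of n]] by simp
  have "measure (\<mu> n) (cell s) \<in> {0..1}" for n s
    using prob_space.prob_le_1[OF prob] by simp
  then obtain r p where r: "strict_mono r" and p: "\<And>s. (\<lambda>n. measure (\<mu> (r n)) (cell s)) \<longlonglongrightarrow> p s"
    using convergent_subsequence_countable[of "\<lambda>n s. measure (\<mu> n) (cell s)"] by metis
  have tail: "\<exists>J0. \<forall>J\<ge>J0. \<forall>\<^sub>F n in sequentially. measure (\<mu> (r n)) {x. J \<le> nearest k x} \<le> \<epsilon>"
    if \<epsilon>: "\<epsilon> > 0" for \<epsilon> k
  proof -
    obtain S where "finite S" "\<forall>\<^sub>F n in sequentially. 1 - \<epsilon> \<le> measure (\<mu> n) (\<Union>x\<in>S. ball x ((1/2) ^ Suc k))"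
      using tight[of "(1/2) ^ Suc k" \<epsilon>] \<epsilon> by auto
    from nearest_tight[OF \<mu> this] obtain J0 where
      "\<And>J. J \<ge> J0 \<Longrightarrow> \<forall>\<^sub>F n in sequentially. measure (\<mu> n) {x. J \<le> nearest k x} \<le> \<epsilon>" by metis
    then show ?thesis using eventually_subseq[OF r] by blast
  qed
  interpret tree_weights p
  proof
    show "0 \<le> p s" for s by (rule LIMSEQ_le_const[OF p]) auto
    have "(\<lambda>n. measure (\<mu> (r n)) (cell [])) = (\<lambda>_. 1)"
      using prob_space.prob_space[OF prob] by (simp add: cell_Nil space_\<mu>)
    then show "p [] = 1" using p[of "[]"] by (simp add: LIMSEQ_const_iff)
    show "(\<lambda>j. p (j # s)) sums p s" for s
      unfolding sums_def
    proof (rule tendstoI)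
      fix \<epsilon> :: real assume "\<epsilon> > 0"
      then obtain J0 where J0: "\<And>J. J \<ge> J0 \<Longrightarrow>
          \<forall>\<^sub>F n in sequentially. measure (\<mu> (r n)) {x. J \<le> nearest (length s) x} \<le> \<epsilon> / 2"
        using tail[of "\<epsilon> / 2" "length s"] by auto
      \<comment> \<open>With \<open>J\<close> fixed, both bounds of \<open>cell_mass_split\<close>
        pass to the limit in \<open>n\<close>; the tail costs at most \<open>\<epsilon> / 2\<close>,
        which leaves room for the strict inequality.\<close>
      have "dist (\<Sum>j<J. p (j # s)) (p s) < \<epsilon>" if "J \<ge> J0" for J
      proof -
        have lim: "(\<lambda>n. \<Sum>j<J. measure (\<mu> (r n)) (cell (j # s))) \<longlonglongrightarrow> (\<Sum>j<J. p (j # s))"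
          by (intro tendsto_sum p)
        have "(\<Sum>j<J. p (j # s)) \<le> p s"
          using cell_mass_split(1)[OF \<mu>] by (intro LIMSEQ_le[OF lim p]) auto
        moreover have "p s \<le> (\<Sum>j<J. p (j # s)) + \<epsilon> / 2"
        proof (rule tendsto_le[OF _ tendsto_add[OF lim tendsto_const] p])
          show "\<forall>\<^sub>F n in sequentially. measure (\<mu> (r n)) (cell s)
              \<le> (\<Sum>j<J. measure (\<mu> (r n)) (cell (j # s))) + \<epsilon> / 2"
            using J0[OF that]
          proof eventually_elim
            case (elim n)
            with cell_mass_split(2)[OF \<mu>, of "r n" s J] show ?case by linarith
          qed
        qed simp
        ultimately show ?thesis using \<open>\<epsilon> > 0\<close> by (simp add: dist_real_def)
      qed
      then show "\<forall>\<^sub>F J in sequentially. dist (\<Sum>j<J. p (j # s)) (p s) < \<epsilon>"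
        by (rule eventually_sequentiallyI)
    qed
  qed
  interpret U: prob_space unit_lebesgue by (rule prob_space_unit_lebesgue)

  \<comment> \<open>An empty cell has mass 0 under every \<open>\<mu> n\<close>, hence limiting
    weight 0, against positivity along codes.\<close>
  have nonempty: "cell (interval_code p k u) \<noteq> {}" if "u \<in> {0..<1}" for k u
  proof
    assume "cell (interval_code p k u) = {}"
    then have "p (interval_code p k u) = 0"
      using p[of "interval_code p k u"] by (simp add: LIMSEQ_const_iff)
    with interval_code_pos[OF that, of k] show False by simp
  qed
  have mono: "cell (interval_code p l u) \<subseteq> cell (interval_code p k u)" if "k \<le> l" for k l u
    using that by (induction l rule: dec_induct) (use cell_Cons in auto)
  \<comment> \<open>The code has length \<open>Suc k\<close> because its head then belongs to level
    \<open>k\<close>: it names a ball of radius \<open>(1/2) ^ k\<close> containing the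
    cell.\<close>
  define z where "z k u = e (hd (interval_code p (Suc k) u))" for k u
  have dist_z: "dist x (z k u) < (1/2) ^ k" if "x \<in> cell (interval_code p (Suc k) u)" for x k u
    using cell_dist[OF that[unfolded interval_code.simps]] by (simp add: z_def e_def del: left_end.simps)
  have dist_zz: "dist (z l u) (z k u) < 2 * (1/2) ^ k" if u: "u \<in> {0..<1}" and "k \<le> l" for k l u
  proof -
    obtain x where x: "x \<in> cell (interval_code p (Suc l) u)" using nonempty[OF u] by blast
    then have "dist x (z k u) < (1/2) ^ k" using mono[of "Suc k" "Suc l" u] that by (intro dist_z) auto
    moreover have "dist x (z l u) < (1/2) ^ l" using x by (rule dist_z)
    moreover have "(1/2 :: real) ^ l \<le> (1/2) ^ k" using that by (intro power_decreasing) auto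
    ultimately show ?thesis using dist_triangle3[of "z l u" "z k u" x] by linarith
  qed
  have half_pow: "\<exists>k. c * (1/2) ^ k < \<delta>" if "\<delta> > 0" for c \<delta> :: real
  proof -
    have "(\<lambda>k. c * (1/2) ^ k) \<longlonglongrightarrow> c * 0"
      by (intro tendsto_mult tendsto_const LIMSEQ_realpow_zero) auto
    then have "\<forall>\<^sub>F k in sequentially. c * (1/2) ^ k < \<delta>" using that by (intro order_tendstoD) auto
    then show ?thesis by (auto simp: eventually_sequentially)
  qed
  have "\<exists>y. (\<lambda>k. z k u) \<longlonglongrightarrow> y" if u: "u \<in> {0..<1}" for u
  proof -
    have "Cauchy (\<lambda>k. z k u)"
      unfolding Cauchy_altdef
    proof (intro allI impI)
      fix \<delta> :: real assume "\<delta> > 0"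
      \<comment> \<open>Both terms are compared with \<open>z K u\<close>, each at distance below
        \<open>2 * (1/2) ^ K\<close>.\<close>
      then obtain K where K: "4 * (1/2) ^ K < \<delta>" using half_pow by blast
      have "dist (z k u) (z l u) < \<delta>" if "K \<le> k" "k < l" for k l
        using dist_zz[OF u, of K k] dist_zz[OF u, of K l] dist_triangle2[of "z k u" "z l u" "z K u"] that K
        by linarith
      then show "\<exists>M. \<forall>m\<ge>M. \<forall>n>m. dist (z m u) (z n u) < \<delta>" by blast
    qed
    then show ?thesis using complete unfolding convergent_def by blast
  qed
  then obtain Z where Z: "\<And>u. u \<in> {0..<1} \<Longrightarrow> (\<lambda>k. z k u) \<longlonglongrightarrow> Z u" by metis
  have dist_Z: "dist x (Z u) < 4 * (1/2) ^ k"
    if u: "u \<in> {0..<1}" and x: "x \<in> cell (interval_code p (Suc k) u)" for x k u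
  proof -
    have "dist (Z u) (z k u) \<le> 2 * (1/2) ^ k"
      by (rule tendsto_upperbound[OF tendsto_dist[OF Z[OF u] tendsto_const]])
         (auto intro!: eventually_sequentiallyI[of k] less_imp_le dist_zz[OF u])
    with dist_z[OF x] dist_triangle2[of x "Z u" "z k u"] show ?thesis
      using zero_less_power[of "1/2 :: real" k] by linarith
  qed
  have "z k \<in> borel_measurable unit_lebesgue" for k
  proof -
    have "(\<lambda>s. e (hd s)) \<in> measurable (count_space UNIV) borel" by simp
    from measurable_compose[OF interval_code_measurable this] show ?thesis
      by (simp add: z_def[abs_def] del: interval_code.simps)
  qed
  then have Z_meas [measurable]: "Z \<in> borel_measurable unit_lebesgue"
    by (rule borel_measurable_LIMSEQ_metric[where f = z]) (use Z in auto)
  define m where "m = distr unit_lebesgue borel Z"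
  have m: "m \<in> Prob"
    unfolding m_def Prob_def by (auto intro!: U.prob_space_distr)

  \<comment> \<open>A lower bound for nonnegative functions is enough: applied to
    \<open>f + B\<close> and to \<open>B - f\<close> it gives both halves of the
    convergence.\<close>
  have lower: "\<forall>\<^sub>F n in sequentially. c < integral\<^sup>L (\<mu> (r n)) f"
    if f: "continuous_on UNIV f" "\<And>x. 0 \<le> f x" "\<And>x. f x \<le> B" and c: "c < integral\<^sup>L m f"
    for f :: "'a \<Rightarrow> real" and B c
  proof -
    have f_meas [measurable]: "f \<in> borel_measurable borel"
      by (rule borel_measurable_continuous_onI[OF f(1)])
    have bdd: "bdd_below (f ` A)" for A by (rule bdd_belowI[of _ 0]) (use f in auto)
    \<comment> \<open>The infimum over an empty set of reals is unspecified; the default 0 keeps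
      \<open>g\<close> bounded by \<open>B\<close>.\<close>
    define g where "g s = (if cell s = {} then 0 else (INF x\<in>cell s. f x))" for s
    have g_le: "g s \<le> f x" if "x \<in> cell s" for s x
      using that bdd by (auto simp: g_def intro: cINF_lower)
    have g_bound: "\<bar>g s\<bar> \<le> B" for s
    proof (cases "cell s = {}")
      case True
      then show ?thesis using f(2,3)[of undefined] by (simp add: g_def)
    next
      case False
      then obtain x where "x \<in> cell s" by blast
      moreover have "0 \<le> g s" using False f(2) by (auto simp: g_def intro!: cINF_greatest)
      ultimately show ?thesis using g_le[of x s] f(3)[of x] by simp
    qed
    have g_lim: "(\<lambda>k. g (interval_code p (Suc k) u)) \<longlonglongrightarrow> f (Z u)" if u: "u \<in> {0..<1}" for u
    proof (rule tendstoI)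
      fix \<epsilon> :: real assume "\<epsilon> > 0"
      then obtain \<delta> where "\<delta> > 0" and \<delta>: "\<And>x. dist x (Z u) < \<delta> \<Longrightarrow> dist (f x) (f (Z u)) < \<epsilon> / 2"
        using f(1) unfolding continuous_on_iff by (meson UNIV_I half_gt_zero)
      obtain K where K: "4 * (1/2) ^ K < \<delta>" using half_pow[OF \<open>\<delta> > 0\<close>] by blast
      have "dist (g (interval_code p (Suc k) u)) (f (Z u)) < \<epsilon>" if "k \<ge> K" for k
      proof -
        let ?s = "interval_code p (Suc k) u"
        have near: "\<bar>f x - f (Z u)\<bar> < \<epsilon> / 2" if "x \<in> cell ?s" for x
        proof -
          have "(1/2 :: real) ^ k \<le> (1/2) ^ K" using \<open>k \<ge> K\<close> by (intro power_decreasing) auto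
          then have "dist x (Z u) < \<delta>" using dist_Z[OF u that] K by linarith
          then show ?thesis using \<delta> by (simp add: dist_real_def)
        qed
        obtain x where x: "x \<in> cell ?s" using nonempty[OF u] by blast
        have "f (Z u) - \<epsilon> / 2 \<le> (INF x\<in>cell ?s. f x)"
        proof (rule cINF_greatest[OF nonempty[OF u]])
          show "f (Z u) - \<epsilon> / 2 \<le> f x" if "x \<in> cell ?s" for x
            using near[OF that] by linarith
        qed
        then have "f (Z u) - \<epsilon> / 2 \<le> g ?s" using nonempty[OF u] by (simp add: g_def del: interval_code.simps)
        then show ?thesis
          using g_le[OF x] near[OF x] \<open>\<epsilon> > 0\<close> unfolding dist_real_def by linarith
      qed
      then show "\<forall>\<^sub>F k in sequentially. dist (g (interval_code p (Suc k) u)) (f (Z u)) < \<epsilon>"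
        by (rule eventually_sequentiallyI)
    qed
    have "(\<lambda>k. \<integral>u. g (interval_code p (Suc k) u) \<partial>unit_lebesgue) \<longlonglongrightarrow> (\<integral>u. f (Z u) \<partial>unit_lebesgue)"
    proof (rule integral_dominated_convergence[where w = "\<lambda>_. B"]; (intro AE_I2)?)
      show "(\<lambda>u. g (interval_code p (Suc k) u)) \<in> borel_measurable unit_lebesgue" for k
        by (rule measurable_compose[OF interval_code_measurable]) simp
    qed (use g_lim g_bound in auto)
    also have "(\<integral>u. f (Z u) \<partial>unit_lebesgue) = integral\<^sup>L m f"
      unfolding m_def by (rule integral_distr[symmetric]) auto
    finally have "\<forall>\<^sub>F k in sequentially. c < (\<integral>u. g (interval_code p (Suc k) u) \<partial>unit_lebesgue)"
      using c by (rule order_tendstoD)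
    \<comment> \<open>The depth \<open>k\<close> and the finite set \<open>A\<close> are fixed
      before \<open>n\<close> grows, so that only finitely many cell masses have to
      converge.\<close>
    then obtain k where "c < (\<integral>u. g (interval_code p (Suc k) u) \<partial>unit_lebesgue)"
      by (auto simp: eventually_sequentially)
    from integral_interval_code_approx[OF g_bound this]
    obtain A where A: "finite A" "\<And>s. s \<in> A \<Longrightarrow> length s = Suc k" and cA: "c < (\<Sum>s\<in>A. g s * p s)"
      by blast
    have "(\<lambda>n. \<Sum>s\<in>A. g s * measure (\<mu> (r n)) (cell s)) \<longlonglongrightarrow> (\<Sum>s\<in>A. g s * p s)"
      by (intro tendsto_intros p)
    then have "\<forall>\<^sub>F n in sequentially. c < (\<Sum>s\<in>A. g s * measure (\<mu> (r n)) (cell s))"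
      using cA by (rule order_tendstoD)
    then show ?thesis
    proof eventually_elim
      case (elim n)
      also have "(\<Sum>s\<in>A. g s * measure (\<mu> (r n)) (cell s)) \<le> integral\<^sup>L (\<mu> (r n)) f"
        by (rule sum_inf_cell_le_integral[OF \<mu> f_meas f(2,3) A g_le])
      finally show ?case .
    qed
  qed
  show thesis
  proof (rule that[OF r m])
    fix f :: "'a \<Rightarrow> real" assume f: "continuous_on UNIV f" and "bounded (range f)"
    then obtain B where B: "\<And>x. \<bar>f x\<bar> \<le> B" by (auto simp: bounded_iff)
    have int: "integrable \<nu> f" if "\<nu> \<in> Prob" for \<nu>
    proof -
      interpret prob_space \<nu> using that by (simp add: Prob_def)
      have "f \<in> borel_measurable \<nu>"
        using borel_measurable_continuous_onI[OF f] that by (simp add: Prob_def cong: measurable_cong_sets)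
      then show ?thesis using B by (intro integrable_const_bound[where B = B]) auto
    qed
    have up: "(\<integral>x. f x + B \<partial>\<nu>) = integral\<^sup>L \<nu> f + B" and down: "(\<integral>x. B - f x \<partial>\<nu>) = B - integral\<^sup>L \<nu> f"
      if "\<nu> \<in> Prob" for \<nu>
    proof -
      interpret prob_space \<nu> using that by (simp add: Prob_def)
      show "(\<integral>x. f x + B \<partial>\<nu>) = integral\<^sup>L \<nu> f + B" "(\<integral>x. B - f x \<partial>\<nu>) = B - integral\<^sup>L \<nu> f"
        using int[OF that] by (simp_all add: prob_space)
    qed
    have bounds: "0 \<le> f x + B" "f x + B \<le> 2 * B" "0 \<le> B - f x" "B - f x \<le> 2 * B" for x
      using B[of x] by auto
    show "(\<lambda>n. integral\<^sup>L (\<mu> (r n)) f) \<longlonglongrightarrow> integral\<^sup>L m f"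
    proof (rule order_tendstoI)
      fix c assume "c < integral\<^sup>L m f"
      then have "\<forall>\<^sub>F n in sequentially. c + B < (\<integral>x. f x + B \<partial>\<mu> (r n))"
        using bounds by (intro lower[of _ "2 * B"]) (auto intro!: continuous_intros f simp: up m)
      then show "\<forall>\<^sub>F n in sequentially. c < integral\<^sup>L (\<mu> (r n)) f" by (simp add: up \<mu>)
    next
      fix c assume "integral\<^sup>L m f < c"
      then have "\<forall>\<^sub>F n in sequentially. B - c < (\<integral>x. B - f x \<partial>\<mu> (r n))"
        using bounds by (intro lower[of _ "2 * B"]) (auto intro!: continuous_intros f simp: down m)
      then show "\<forall>\<^sub>F n in sequentially. integral\<^sup>L (\<mu> (r n)) f < c" by (simp add: down \<mu>)
    qed
  qed
qed

section \<open>Bump functions\<close>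

context dense_sequence
begin

text \<open>A cone over each ball named by \<open>cs\<close>, where \<open>c\<close> stands for the
  ball of radius \<open>1 / Suc (snd c)\<close> about \<open>e (fst c)\<close>; the factor
  \<open>l\<close> steepens the sum before it is cut off at 1. Natural-number data keep the family
  countable.\<close>

definition bump :: "nat \<Rightarrow> (nat \<times> nat) list \<Rightarrow> 'a \<Rightarrow> real" where
  "bump l cs x = min 1 (real l * (\<Sum>c\<in>set cs. max 0 (1 / Suc (snd c) - dist x (e (fst c)))))"

text \<open>The same \<open>l\<close> bounds the enumeration of balls and, in the combination with
  \<open>bump l\<close>, the steepness, so that a single limit both exhausts the balls and turns the
  cones into an indicator.\<close>

definition select :: "(nat \<times> nat \<Rightarrow> bool) \<Rightarrow> nat \<Rightarrow> (nat \<times> nat) list" where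
  "select Q l = filter Q (map from_nat [0..<l])"

lemma bump_continuous: "continuous_on UNIV (bump l cs)"
  unfolding bump_def by (intro continuous_intros)

lemma bump_measurable [measurable]: "bump l cs \<in> borel_measurable borel"
  by (rule borel_measurable_continuous_onI[OF bump_continuous])

lemma bump_range: "bump l cs x \<in> {0..1}"
  by (auto simp: bump_def intro!: mult_nonneg_nonneg sum_nonneg)

lemma bump_bounded: "bounded (range (bump l cs))"
  by (rule bounded_subset[OF bounded_closed_interval]) (use bump_range in blast)

lemma integrable_bump:
  assumes "m \<in> Prob"
  shows "integrable m (bump l cs)"
proof -
  interpret prob_space m using assms by (simp add: Prob_def)
  have "bump l cs \<in> borel_measurable m" using assms by (simp add: Prob_def cong: measurable_cong_sets)
  then show ?thesis
    by (intro integrable_const_bound[where B = 1]) (use bump_range in \<open>auto simp: abs_le_iff intro!: AE_I2\<close>)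
qed

lemma bump_eq_0: "x \<notin> (\<Union>c\<in>set cs. ball (e (fst c)) (1 / Suc (snd c))) \<Longrightarrow> bump l cs x = 0"
  unfolding bump_def by (subst sum.neutral) (auto simp: dist_commute not_less)

text \<open>Inside the union some cone has height \<open>a > 0\<close> at the point, and the value
  is 1 as soon as its ball has been enumerated and \<open>l * a\<close> exceeds 1. Outside, all
  cones vanish.\<close>

lemma bump_select_tendsto:
  "(\<lambda>l. bump l (select Q l) x) \<longlonglongrightarrow> indicator (\<Union>c\<in>Collect Q. ball (e (fst c)) (1 / Suc (snd c))) x"
proof (cases "x \<in> (\<Union>c\<in>Collect Q. ball (e (fst c)) (1 / Suc (snd c)))")
  case False
  then have "bump l (select Q l) x = 0" for l
    by (intro bump_eq_0) (auto simp: select_def)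
  with False show ?thesis by simp
next
  case True
  then obtain c where c: "Q c" "dist x (e (fst c)) < 1 / Suc (snd c)"
    by (auto simp: dist_commute)
  define a where "a = 1 / Suc (snd c) - dist x (e (fst c))"
  have "a > 0" using c by (simp add: a_def)
  then obtain l0 :: nat where l0: "1 < real l0 * a"
    using reals_Archimedean3 by blast
  have "bump l (select Q l) x = 1" if l: "l \<ge> l0" "l > to_nat c" for l
  proof -
    have "c \<in> set (select Q l)" using c(1) l by (auto simp: select_def intro!: image_eqI[of _ _ "to_nat c"])
    then have "a \<le> (\<Sum>c\<in>set (select Q l). max 0 (1 / Suc (snd c) - dist x (e (fst c))))"
      using member_le_sum[of c "set (select Q l)" "\<lambda>c. max 0 (1 / Suc (snd c) - dist x (e (fst c)))"]
      by (auto simp: a_def)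
    then have "real l0 * a \<le> real l * (\<Sum>c\<in>set (select Q l). max 0 (1 / Suc (snd c) - dist x (e (fst c))))"
      using l \<open>a > 0\<close> by (intro mult_mono) auto
    with l0 show ?thesis by (simp add: bump_def)
  qed
  then have "\<forall>\<^sub>F l in sequentially. bump l (select Q l) x = 1"
    by (intro eventually_sequentiallyI[of "max l0 (Suc (to_nat c))"]) auto
  with True show ?thesis by (simp add: tendsto_eventually)
qed

lemma integral_bump_select_tendsto:
  assumes "m \<in> Prob"
  shows "(\<lambda>l. integral\<^sup>L m (bump l (select Q l)))
    \<longlonglongrightarrow> measure m (\<Union>c\<in>Collect Q. ball (e (fst c)) (1 / Suc (snd c)))" (is "_ \<longlonglongrightarrow> measure m ?G")
proof -
  interpret prob_space m using assms by (simp add: Prob_def)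
  have sets: "events = sets borel" using assms by (simp add: Prob_def)
  then have space: "space m = UNIV" by (metis sets_eq_imp_space_eq space_borel)
  have "?G \<in> events" by (simp add: sets open_UN)
  moreover have "(\<lambda>l. integral\<^sup>L m (bump l (select Q l))) \<longlonglongrightarrow> (\<integral>x. indicator ?G x \<partial>m)"
  proof (rule integral_dominated_convergence[where w = "\<lambda>_. 1"]; (intro AE_I2)?)
    show "bump l (select Q l) \<in> borel_measurable m" for l
      using sets by (simp cong: measurable_cong_sets)
    show "norm (bump l (select Q l) x) \<le> 1" for l x
      using bump_range[of l "select Q l" x] by simp
    show "(\<lambda>l. bump l (select Q l) x) \<longlonglongrightarrow> indicator ?G x" for x
      by (rule bump_select_tendsto)
  qed (use \<open>?G \<in> events\<close> in auto)
  ultimately show ?thesis by (simp add: space)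
qed

lemma ball_cover_eq:
  assumes "open G"
  shows "(\<Union>c\<in>{c. ball (e (fst c)) (1 / Suc (snd c)) \<subseteq> G}. ball (e (fst c)) (1 / Suc (snd c))) = G"
proof (intro antisym subsetI)
  fix x assume "x \<in> G"
  then obtain \<delta> where \<delta>: "\<delta> > 0" "ball x \<delta> \<subseteq> G" using assms open_contains_ball by blast
  obtain k where k: "1 / Suc k < \<delta> / 2" using \<delta>(1) nat_approx_posE[of "\<delta> / 2"] by auto
  obtain j where j: "dist x (e j) < 1 / Suc k" using dense[of "1 / Suc k" x] by auto
  have "ball (e j) (1 / Suc k) \<subseteq> ball x \<delta>"
  proof
    fix y assume "y \<in> ball (e j) (1 / Suc k)"
    with j k dist_triangle[of x y "e j"] show "y \<in> ball x \<delta>" by simp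
  qed
  with \<delta> j show "x \<in> (\<Union>c\<in>{c. ball (e (fst c)) (1 / Suc (snd c)) \<subseteq> G}. ball (e (fst c)) (1 / Suc (snd c)))"
    by (intro UN_I[of "(j, k)"]) (auto simp: dist_commute)
qed auto

text \<open>By \<open>ball_cover_eq\<close> the measure of every open set is a limit of bump
  integrals, and the open sets form an intersection-stable generator of the Borel sets.\<close>

lemma measure_eqI_bump:
  assumes m: "m \<in> Prob" and m': "m' \<in> Prob"
    and eq: "\<And>l cs. integral\<^sup>L m (bump l cs) = integral\<^sup>L m' (bump l cs)"
  shows "m = m'"
proof -
  interpret m: prob_space m using m by (simp add: Prob_def)
  interpret m': prob_space m' using m' by (simp add: Prob_def)
  have sets: "sets m = sigma_sets UNIV {S. open S}" "sets m' = sigma_sets UNIV {S. open S}"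
    using m m' by (auto simp: Prob_def borel_def)
  have "measure m G = measure m' G" if "open G" for G
    using integral_bump_select_tendsto[OF m, of "\<lambda>c. ball (e (fst c)) (1 / Suc (snd c)) \<subseteq> G"]
      integral_bump_select_tendsto[OF m', of "\<lambda>c. ball (e (fst c)) (1 / Suc (snd c)) \<subseteq> G"]
    unfolding ball_cover_eq[OF that] eq by (rule LIMSEQ_unique)
  then show ?thesis
    by (intro measure_eqI_generator_eq[where \<Omega> = UNIV and E = "{S. open S}" and A = "\<lambda>_. UNIV"])
       (auto simp: sets Int_stable_def m.emeasure_eq_measure m'.emeasure_eq_measure)
qed

text \<open>The named balls of radius at most \<open>r\<close> cover the space, so a single bump
  function built from finitely many of them has integral above \<open>1 - \<epsilon>\<close> under
  \<open>L\<close>. Its integral under \<open>\<mu> n\<close> eventually exceeds that value too, and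
  it vanishes off those balls.\<close>

lemma tight_bump:
  assumes L: "L \<in> Prob" and \<mu>: "\<And>n. \<mu> n \<in> Prob"
    and lim: "\<And>l cs. (\<lambda>n. integral\<^sup>L (\<mu> n) (bump l cs)) \<longlonglongrightarrow> integral\<^sup>L L (bump l cs)"
    and r: "r > 0" and \<epsilon>: "\<epsilon> > 0"
  shows "\<exists>S. finite S \<and> (\<forall>\<^sub>F n in sequentially. 1 - \<epsilon> \<le> measure (\<mu> n) (\<Union>x\<in>S. ball x r))"
proof -
  define Q where "Q c \<longleftrightarrow> 1 / Suc (snd c) \<le> r" for c :: "nat \<times> nat"
  interpret L: prob_space L using L by (simp add: Prob_def)
  have "x \<in> (\<Union>c\<in>Collect Q. ball (e (fst c)) (1 / Suc (snd c)))" for x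
  proof -
    obtain k where k: "1 / Suc k < r" using r nat_approx_posE by blast
    obtain j where "dist x (e j) < 1 / Suc k" using dense[of "1 / Suc k" x] by auto
    with k show ?thesis by (intro UN_I[of "(j, k)"]) (auto simp: Q_def dist_commute)
  qed
  then have "(\<Union>c\<in>Collect Q. ball (e (fst c)) (1 / Suc (snd c))) = space L"
    using sets_eq_imp_space_eq[of L borel] L by (auto simp: Prob_def)
  then have "(\<lambda>l. integral\<^sup>L L (bump l (select Q l))) \<longlonglongrightarrow> 1"
    using integral_bump_select_tendsto[OF L, of Q] by (simp add: L.prob_space)
  then have "\<forall>\<^sub>F l in sequentially. 1 - \<epsilon> < integral\<^sup>L L (bump l (select Q l))"
    using \<epsilon> by (intro order_tendstoD) auto
  then obtain l where l: "1 - \<epsilon> < integral\<^sup>L L (bump l (select Q l))"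
    by (auto simp: eventually_sequentially)
  define S where "S = (e \<circ> fst) ` set (select Q l)"
  have "\<forall>\<^sub>F n in sequentially. 1 - \<epsilon> < integral\<^sup>L (\<mu> n) (bump l (select Q l))"
    by (rule order_tendstoD(1)[OF lim l])
  then have "\<forall>\<^sub>F n in sequentially. 1 - \<epsilon> \<le> measure (\<mu> n) (\<Union>x\<in>S. ball x r)"
  proof eventually_elim
    case (elim n)
    interpret prob_space "\<mu> n" using \<mu>[of n] by (simp add: Prob_def)
    have sets: "sets (\<mu> n) = sets borel" using \<mu>[of n] by (simp add: Prob_def)
    then have space: "space (\<mu> n) = UNIV" by (metis sets_eq_imp_space_eq space_borel)
    have meas: "(\<Union>x\<in>S. ball x r) \<in> events" by (simp add: sets open_UN)
    have "integral\<^sup>L (\<mu> n) (bump l (select Q l)) \<le> (\<integral>x. indicator (\<Union>x\<in>S. ball x r) x \<partial>\<mu> n)"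
    proof (rule integral_mono)
      show "integrable (\<mu> n) (bump l (select Q l))" by (rule integrable_bump[OF \<mu>])
      show "integrable (\<mu> n) (\<lambda>x. indicator (\<Union>x\<in>S. ball x r) x :: real)"
        using meas by (intro integrable_real_indicator) (auto simp: emeasure_eq_measure)
      show "bump l (select Q l) x \<le> indicator (\<Union>x\<in>S. ball x r) x" for x
      proof (cases "x \<in> (\<Union>x\<in>S. ball x r)")
        case True
        then show ?thesis using bump_range[of l "select Q l" x] by simp
      next
        case False
        have "x \<notin> ball (e (fst c)) (1 / Suc (snd c))" if c: "c \<in> set (select Q l)" for c
        proof
          assume "x \<in> ball (e (fst c)) (1 / Suc (snd c))"
          moreover have "1 / Suc (snd c) \<le> r" using c by (simp add: select_def Q_def)
          ultimately have "x \<in> ball (e (fst c)) r" by simp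
          then have "x \<in> (\<Union>x\<in>S. ball x r)" unfolding S_def by (rule UN_I[rotated]) (use c in auto)
          with False show False by contradiction
        qed
        then have "x \<notin> (\<Union>c\<in>set (select Q l). ball (e (fst c)) (1 / Suc (snd c)))" by simp
        then show ?thesis by (simp add: bump_eq_0)
      qed
    qed
    then show ?case using elim meas by (simp add: space)
  qed
  moreover have "finite S" by (simp add: S_def)
  ultimately show ?thesis by blast
qed

end

text \<open>Separability reduces all null balls to countably many: a null ball around
  \<open>z\<close> contains a null ball with centre in \<open>D\<close> and radius
  \<open>1 / Suc k\<close> that still contains \<open>z\<close>.\<close>

lemma AE_in_support:
  fixes m :: "'a::metric_space measure" and D :: "'a set"
  assumes m: "m \<in> Prob" and D: "countable D" "\<And>x r. r > 0 \<Longrightarrow> \<exists>y\<in>D. dist x y < r"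
  shows "AE z in m. \<forall>\<delta>>0. measure m (ball z \<delta>) > 0"
proof -
  interpret prob_space m using m by (simp add: Prob_def)
  have [simp]: "events = sets borel" using m by (simp add: Prob_def)
  define I where "I = {(y :: 'a, k :: nat). y \<in> D \<and> measure m (ball y (1 / real (Suc k))) = 0}"
  have "countable I"
    by (rule countable_subset[of _ "D \<times> (UNIV :: nat set)"]) (auto simp: I_def D(1))
  then have null: "(\<Union>(y, k)\<in>I. ball y (1 / real (Suc k))) \<in> null_sets m"
    by (intro null_sets_UN') (auto simp: I_def null_sets_def emeasure_eq_measure)
  show ?thesis
  proof (rule AE_I'[OF null], rule subsetI, rule ccontr)
    fix z assume z: "z \<in> {z \<in> space m. \<not> (\<forall>\<delta>>0. measure m (ball z \<delta>) > 0)}"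
      and notin: "z \<notin> (\<Union>(y, k)\<in>I. ball y (1 / real (Suc k)))"
    from z obtain \<delta> where \<delta>: "\<delta> > 0" "measure m (ball z \<delta>) \<le> 0" by (auto simp: not_less)
    obtain k where k: "1 / real (Suc k) < \<delta> / 2" using \<delta>(1) nat_approx_posE[of "\<delta> / 2"] by auto
    obtain y where y: "y \<in> D" "dist z y < 1 / real (Suc k)" using D(2)[of "1 / real (Suc k)" z] by auto
    have "ball y (1 / real (Suc k)) \<subseteq> ball z \<delta>"
    proof
      fix x assume "x \<in> ball y (1 / real (Suc k))"
      with y k dist_triangle[of z x y] show "x \<in> ball z \<delta>" by simp
    qed
    then have "measure m (ball y (1 / real (Suc k))) \<le> measure m (ball z \<delta>)"
      by (intro finite_measure_mono) auto
    then have "(y, k) \<in> I" using \<delta>(2) y(1) by (simp add: I_def measure_le_0_iff)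
    with notin y show False by (auto simp: dist_commute)
  qed
qed

section \<open>Limits of Nash equilibria\<close>

text \<open>For each support point \<open>z\<close> the players nearest to it are chosen once,
  independently of the deviation. The subsequence supplied by \<open>continuous_corr\<close> varies
  with \<open>y\<close>, which is harmless because the resulting inequality involves only
  \<open>m\<close>, \<open>z\<close> and \<open>y\<close>.\<close>

lemma nash_limit_CN:
  fixes F :: "('w::metric_space \<times> 'x::metric_space) measure \<Rightarrow> 'w \<Rightarrow> 'x \<Rightarrow> real"
    and C :: "'w \<Rightarrow> 'x set" and w :: "nat \<Rightarrow> nat \<Rightarrow> 'w" and x :: "nat \<Rightarrow> nat \<Rightarrow> 'x"
  assumes D: "countable (D :: ('w \<times> 'x) set)" "\<And>z r. r > 0 \<Longrightarrow> \<exists>y\<in>D. dist z y < r"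
    and C_cont: "continuous_corr C"
    and F_bounded: "\<exists>B. \<forall>m\<in>Prob. \<forall>w x. \<bar>F m w x\<bar> \<le> B"
    and F_cont: "continuous_map (prod_topology weak_top euclidean) euclideanreal
                   (\<lambda>(m, p). F m (fst p) (snd p))"
    and N_pos: "\<And>n. N n > 0" and N_top: "filterlim N at_top sequentially"
    and nash: "\<And>n. nash F C (N n) (w n) (x n)"
    and m: "m \<in> Prob"
    and lim: "\<And>f :: 'w \<times> 'x \<Rightarrow> real. continuous_on UNIV f \<Longrightarrow> bounded (range f) \<Longrightarrow>
        (\<lambda>n. integral\<^sup>L (empirical (N n) (\<lambda>i. (w n i, x n i))) f) \<longlonglongrightarrow> integral\<^sup>L m f"
  shows "AE p in m. snd p \<in> C (fst p) \<and> F m (fst p) (snd p) = (INF y\<in>C (fst p). F m (fst p) y)"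
proof -
  define \<mu> where "\<mu> n = empirical (N n) (\<lambda>i. (w n i, x n i))" for n
  interpret prob_space m using m by (simp add: Prob_def)
  have [simp]: "events = sets borel" using m by (simp add: Prob_def)
  have [simp]: "space m = UNIV" using m by (metis \<open>events = sets borel\<close> sets_eq_imp_space_eq space_borel)
  obtain B where B: "\<And>m w x. m \<in> Prob \<Longrightarrow> \<bar>F m w x\<bar> \<le> B" using F_bounded by blast
  \<comment> \<open>A real infimum is a lower bound only for a set bounded below. The measure may
    vary with \<open>y\<close>, as a deviation also changes the empirical measure.\<close>
  have bdd: "bdd_below ((\<lambda>y. F (M y) a y) ` A)" if "\<And>y. M y \<in> Prob" for M a A
  proof (rule bdd_belowI2)
    show "- B \<le> F (M y) a y" for y using B[OF that[of y], of a y] by linarith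
  qed
  have F_lim: "(\<lambda>n. F (M n) (a n) (b n)) \<longlonglongrightarrow> F m a' b'"
    if "limitin weak_top M m sequentially" "a \<longlonglongrightarrow> a'" "b \<longlonglongrightarrow> b'" for M a b a' b'
  proof -
    have "limitin (prod_topology weak_top euclidean) (\<lambda>n. (M n, (a n, b n))) (m, (a', b')) sequentially"
      using that by (simp add: limitin_pairwise o_def limitin_canonical_iff tendsto_Pair)
    from continuous_map_limit[OF F_cont this] show ?thesis
      by (simp add: o_def limitin_canonical_iff)
  qed
  have "AE z in m. \<forall>\<delta>>0. measure m (ball z \<delta>) > 0"
    by (rule AE_in_support[OF m D])
  then show ?thesis
  proof eventually_elim
    case (elim z)
    have "\<exists>i<N n. \<forall>j<N n. dist (w n i, x n i) z \<le> dist (w n j, x n j) z" for n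
    proof -
      let ?d = "\<lambda>j. dist (w n j, x n j) z"
      have "Min (?d ` {..<N n}) \<in> ?d ` {..<N n}" using N_pos[of n] by (intro Min_in) auto
      then obtain i where "i < N n" "Min (?d ` {..<N n}) = ?d i" by auto
      moreover have "Min (?d ` {..<N n}) \<le> ?d j" if "j < N n" for j using that by (intro Min_le) auto
      ultimately show ?thesis by metis
    qed
    then obtain i where i: "\<And>n. i n < N n"
      and i_min: "\<And>n j. j < N n \<Longrightarrow> dist (w n (i n), x n (i n)) z \<le> dist (w n j, x n j) z"
      by metis
    have z_lim: "(\<lambda>n. (w n (i n), x n (i n))) \<longlonglongrightarrow> z"
    proof (rule tendstoI)
      fix \<delta> :: real assume \<delta>: "\<delta> > 0"
      \<comment> \<open>A cone around \<open>z\<close>, at least \<open>\<delta> / 2\<close> on the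
        half-radius ball, which has positive mass, and zero beyond distance \<delta>: a positive
        empirical integral exhibits a player within \<delta>.\<close>
      define h where "h q = max 0 (\<delta> - dist q z)" for q :: "'w \<times> 'x"
      have h_cont: "continuous_on UNIV h" unfolding h_def by (intro continuous_intros)
      have h_range: "h q \<in> {0..\<delta>}" for q using \<delta> by (auto simp: h_def)
      have h_bdd: "bounded (range h)"
        by (rule bounded_subset[OF bounded_closed_interval]) (use h_range in blast)
      have h_meas: "h \<in> borel_measurable borel" by (rule borel_measurable_continuous_onI[OF h_cont])
      have "\<delta> / 2 * measure m (ball z (\<delta> / 2)) = (\<integral>q. \<delta> / 2 * indicator (ball z (\<delta> / 2)) q \<partial>m)"
        by simp
      also have "\<dots> \<le> integral\<^sup>L m h"
      proof (rule integral_mono)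
        show "integrable m (\<lambda>q. \<delta> / 2 * indicator (ball z (\<delta> / 2)) q)"
          by (intro integrable_mult_right integrable_real_indicator) (auto simp: emeasure_eq_measure)
        show "integrable m h"
          using h_range h_meas
          by (intro integrable_const_bound[where B = \<delta>]) (auto cong: measurable_cong_sets)
        show "\<delta> / 2 * indicator (ball z (\<delta> / 2)) q \<le> h q" for q
          using \<delta> by (auto simp: h_def indicator_def dist_commute)
      qed
      finally have "\<delta> / 2 * measure m (ball z (\<delta> / 2)) \<le> integral\<^sup>L m h" .
      moreover have "0 < \<delta> / 2 * measure m (ball z (\<delta> / 2))"
        using elim[rule_format, of "\<delta> / 2"] \<delta> by (intro mult_pos_pos) auto
      ultimately have "0 < integral\<^sup>L m h" by linarith
      with lim[OF h_cont h_bdd] have "\<forall>\<^sub>F n in sequentially. 0 < integral\<^sup>L (\<mu> n) h"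
        unfolding \<mu>_def by (rule order_tendstoD)
      then show "\<forall>\<^sub>F n in sequentially. dist (w n (i n), x n (i n)) z < \<delta>"
      proof eventually_elim
        case (elim n)
        then have "0 < (\<Sum>j<N n. h (w n j, x n j))"
          using N_pos[of n] by (simp add: \<mu>_def integral_empirical[OF h_meas] zero_less_divide_iff)
        then obtain j where j: "j < N n" "0 < h (w n j, x n j)"
          by (meson lessThan_iff not_less sum_nonpos)
        then have "dist (w n j, x n j) z < \<delta>" by (simp add: h_def less_max_iff_disj)
        with i_min[OF j(1)] show ?case by simp
      qed
    qed
    define a b where "a n = w n (i n)" and "b n = x n (i n)" for n
    have a: "a \<longlonglongrightarrow> fst z" using tendsto_fst[OF z_lim] by (simp add: a_def[abs_def])
    have b: "b \<longlonglongrightarrow> snd z" using tendsto_snd[OF z_lim] by (simp add: b_def[abs_def])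
    have "b n \<in> C (a n)" for n using nash[of n] i[of n] by (auto simp: nash_def a_def b_def)
    then have "(a n, b n) \<in> {(w, x). x \<in> C w}" for n by simp
    moreover have "closed {(w, x). x \<in> C w}" using C_cont by (simp add: continuous_corr_def)
    moreover have "(\<lambda>n. (a n, b n)) \<longlonglongrightarrow> z" using z_lim by (simp add: a_def b_def)
    ultimately have "z \<in> {(w, x). x \<in> C w}"
      using closed_sequentially[of "{(w, x). x \<in> C w}" "\<lambda>n. (a n, b n)" z] by blast
    then have z_C: "snd z \<in> C (fst z)" by auto
    have le: "F m (fst z) (snd z) \<le> F m (fst z) y" if y: "y \<in> C (fst z)" for y
    proof -
      obtain r ys where r: "strict_mono r" and ys: "\<And>k. ys k \<in> C (a (r k))" "ys \<longlonglongrightarrow> y"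
        using C_cont a y unfolding continuous_corr_def by metis
      define \<mu>' where "\<mu>' k = empirical (N (r k)) (\<lambda>j. (w (r k) j, ((x (r k))(i (r k) := ys k)) j))" for k
      have Nr: "filterlim (\<lambda>k. real (N (r k))) at_top sequentially"
        using filterlim_compose[OF filterlim_real_sequentially
            filterlim_compose[OF N_top filterlim_subseq[OF r]]] by simp
      \<comment> \<open>Only the summand of player \<open>i (r k)\<close> changes, so the two
        integrals of a bounded \<open>f\<close> differ by at most twice its bound over
        \<open>N (r k)\<close>.\<close>
      have int_diff: "integral\<^sup>L (\<mu>' k) f = integral\<^sup>L (\<mu> (r k)) f + (f (a (r k), ys k) - f (a (r k), b (r k))) / N (r k)"
        if "f \<in> borel_measurable borel" for f :: "'w \<times> 'x \<Rightarrow> real" and k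
      proof -
        have "(\<Sum>j<N (r k). f (w (r k) j, ((x (r k))(i (r k) := ys k)) j)) - (\<Sum>j<N (r k). f (w (r k) j, x (r k) j))
          = (\<Sum>j<N (r k). if j = i (r k) then f (a (r k), ys k) - f (a (r k), b (r k)) else 0)"
          unfolding sum_subtractf[symmetric] by (intro sum.cong) (auto simp: a_def b_def)
        also have "\<dots> = f (a (r k), ys k) - f (a (r k), b (r k))"
          using i[of "r k"] by simp
        finally have "(\<Sum>j<N (r k). f (w (r k) j, ((x (r k))(i (r k) := ys k)) j))
          = (\<Sum>j<N (r k). f (w (r k) j, x (r k) j)) + (f (a (r k), ys k) - f (a (r k), b (r k)))"
          by linarith
        then show ?thesis
          unfolding \<mu>_def \<mu>'_def integral_empirical[OF that] by (simp only: add_divide_distrib)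
      qed
      have "limitin weak_top \<mu>' m sequentially"
      proof (rule limitin_weak_topI[OF m])
        show "\<mu>' n \<in> Prob" for n unfolding \<mu>'_def by (rule empirical_Prob[OF N_pos])
        fix f :: "'w \<times> 'x \<Rightarrow> real" assume f: "continuous_on UNIV f" "bounded (range f)"
        obtain K where K: "\<And>q. \<bar>f q\<bar> \<le> K" using f(2) by (auto simp: bounded_iff)
        have null: "(\<lambda>k. (f (a (r k), ys k) - f (a (r k), b (r k))) / N (r k)) \<longlonglongrightarrow> 0"
        proof (rule Lim_null_comparison)
          show "\<forall>\<^sub>F k in sequentially. norm ((f (a (r k), ys k) - f (a (r k), b (r k))) / N (r k)) \<le> 2 * K / N (r k)"
          proof (intro always_eventually allI)
            fix k
            show "norm ((f (a (r k), ys k) - f (a (r k), b (r k))) / N (r k)) \<le> 2 * K / N (r k)"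
              using K[of "(a (r k), ys k)"] K[of "(a (r k), b (r k))"]
              by (auto simp: abs_divide intro!: divide_right_mono)
          qed
          show "(\<lambda>k. 2 * K / N (r k)) \<longlonglongrightarrow> 0"
            by (rule real_tendsto_divide_at_top[OF tendsto_const Nr])
        qed
        have "(\<lambda>k. integral\<^sup>L (\<mu> (r k)) f) \<longlonglongrightarrow> integral\<^sup>L m f"
          using LIMSEQ_subseq_LIMSEQ[OF lim[OF f] r] by (simp add: \<mu>_def o_def)
        from tendsto_add[OF this null] show "(\<lambda>k. integral\<^sup>L (\<mu>' k) f) \<longlonglongrightarrow> integral\<^sup>L m f"
          unfolding int_diff[OF borel_measurable_continuous_onI[OF f(1)]] by simp
      qed
      then have "(\<lambda>k. F (\<mu>' k) (a (r k)) (ys k)) \<longlonglongrightarrow> F m (fst z) y"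
        using F_lim LIMSEQ_subseq_LIMSEQ[OF a r] ys(2) by (simp add: o_def)
      moreover have "limitin weak_top (\<lambda>k. \<mu> (r k)) m sequentially"
      proof (rule limitin_weak_topI[OF m])
        show "\<mu> (r n) \<in> Prob" for n unfolding \<mu>_def by (rule empirical_Prob[OF N_pos])
        show "(\<lambda>n. integral\<^sup>L (\<mu> (r n)) f) \<longlonglongrightarrow> integral\<^sup>L m f"
          if "continuous_on UNIV f" "bounded (range f)" for f :: "'w \<times> 'x \<Rightarrow> real"
          using LIMSEQ_subseq_LIMSEQ[OF lim[OF that] r] by (simp add: \<mu>_def o_def)
      qed
      then have "(\<lambda>k. F (\<mu> (r k)) (a (r k)) (b (r k))) \<longlonglongrightarrow> F m (fst z) (snd z)"
        using F_lim LIMSEQ_subseq_LIMSEQ[OF a r] LIMSEQ_subseq_LIMSEQ[OF b r] by (simp add: o_def)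
      moreover have "F (\<mu> (r k)) (a (r k)) (b (r k)) \<le> F (\<mu>' k) (a (r k)) (ys k)" for k
      proof -
        let ?M = "\<lambda>y. empirical (N (r k)) (\<lambda>j. (w (r k) j, ((x (r k))(i (r k) := y)) j))"
        have "F (\<mu> (r k)) (a (r k)) (b (r k)) = (INF y\<in>C (a (r k)). F (?M y) (a (r k)) y)"
          using nash[of "r k"] i[of "r k"] unfolding nash_def \<mu>_def a_def b_def by blast
        also have "\<dots> \<le> F (?M (ys k)) (a (r k)) (ys k)"
          using ys(1)[of k] by (intro cINF_lower bdd empirical_Prob N_pos)
        finally show ?thesis by (simp add: \<mu>'_def)
      qed
      ultimately show ?thesis by (intro LIMSEQ_le) auto
    qed
    have "F m (fst z) (snd z) = (INF y\<in>C (fst z). F m (fst z) y)"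
    proof (rule antisym)
      show "F m (fst z) (snd z) \<le> (INF y\<in>C (fst z). F m (fst z) y)"
        using z_C le by (intro cINF_greatest) auto
      show "(INF y\<in>C (fst z). F m (fst z) y) \<le> F m (fst z) (snd z)"
        using z_C m by (intro cINF_lower bdd)
    qed
    with z_C show ?case by simp
  qed
qed

section \<open>Convergence of the empirical measures\<close>

lemma empirical_cong:
  assumes "\<And>i. i < n \<Longrightarrow> p i = q i"
  shows "empirical n p = empirical n q"
  unfolding empirical_def using assms
  by (intro distr_cong) (auto simp: space_uniform_count_measure)

text \<open>The equilibrium condition sees the types of the first \<open>n\<close> players only;
  this moves it from the restricted vector, on which \<open>xhat\<close> is evaluated, to the whole
  type sequence.\<close>

lemma nash_cong:
  fixes x :: "nat \<Rightarrow> 'x::topological_space" and w :: "nat \<Rightarrow> 'w::topological_space"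
  assumes w: "\<And>i. i < n \<Longrightarrow> w i = w' i" and nash: "nash F C n w x"
  shows "nash F C n w' x"
  unfolding nash_def
proof (intro allI impI)
  fix i assume i: "i < n"
  have eq: "empirical n (\<lambda>k. (w' k, z k)) = empirical n (\<lambda>k. (w k, z k))" for z :: "nat \<Rightarrow> 'x"
    using w by (intro empirical_cong) auto
  show "x i \<in> C (w' i) \<and> F (empirical n (\<lambda>k. (w' k, x k))) (w' i) (x i) =
      (INF y\<in>C (w' i). F (empirical n (\<lambda>k. (w' k, (x(i := y)) k))) (w' i) y)"
    unfolding eq w[OF i, symmetric] using nash i unfolding nash_def by blast
qed

section \<open>Separability, completeness and tightness of the product space\<close>

lemma countable_dense_of_compact:
  assumes "compact (UNIV :: 'a::metric_space set)"
  obtains D :: "'a::metric_space set" where "countable D" "\<And>x r. r > 0 \<Longrightarrow> \<exists>y\<in>D. dist x y < r"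
proof -
  have "\<exists>K. finite K \<and> (\<forall>x::'a. \<exists>y\<in>K. dist x y < 1 / real (Suc n))" for n
  proof -
    obtain K :: "'a set" where "finite K" and K: "UNIV \<subseteq> (\<Union>y\<in>K. ball y (1 / real (Suc n)))"
      using seq_compact_imp_totally_bounded[OF compact_imp_seq_compact[OF assms], rule_format, of "1 / real (Suc n)"]
      by auto
    moreover have "\<exists>y\<in>K. dist x y < 1 / real (Suc n)" for x
      using subsetD[OF K UNIV_I[of x]] by (simp add: dist_commute)
    ultimately show ?thesis by blast
  qed
  then obtain K where K: "\<And>n. finite (K n)" "\<And>n x. \<exists>y\<in>K n. dist (x :: 'a) y < 1 / real (Suc n)"
    by metis
  have "\<exists>y\<in>\<Union>(range K). dist x y < r" if r: "r > 0" for x r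
  proof -
    obtain n where n: "1 / real (Suc n) < r" by (rule nat_approx_posE[OF r])
    obtain y where "y \<in> K n" "dist x y < 1 / real (Suc n)" using K(2) by blast
    with n show ?thesis by (intro bexI[of _ y]) auto
  qed
  moreover have "countable (\<Union>(range K))" using K(1) by (auto intro: countable_finite)
  ultimately show thesis using that by blast
qed

lemma dist_prod_le: "dist p q \<le> dist (fst p) (fst q) + dist (snd p) (snd q)"
  by (simp add: dist_prod_def sqrt_sum_squares_le_sum)

lemma dense_Times:
  assumes "\<And>x r. r > 0 \<Longrightarrow> \<exists>y\<in>D. dist x y < r" "\<And>x r. r > 0 \<Longrightarrow> \<exists>y\<in>E. dist x y < r"
    and "r > 0"
  shows "\<exists>q\<in>D \<times> E. dist p q < r"
proof -
  obtain y z where "y \<in> D" "dist (fst p) y < r / 2" "z \<in> E" "dist (snd p) z < r / 2"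
    using assms half_gt_zero by metis
  with dist_prod_le[of p "(y, z)"] show ?thesis by (intro bexI[of _ "(y, z)"]) auto
qed

lemma Cauchy_imp_convergent_compact:
  assumes "compact (UNIV :: 'a::metric_space set)" and X: "Cauchy (X :: nat \<Rightarrow> 'a)"
  shows "convergent X"
proof -
  obtain l r where "strict_mono r" "(X \<circ> r) \<longlonglongrightarrow> l"
    using compact_imp_seq_compact[OF assms(1)] unfolding seq_compact_def by (metis UNIV_I)
  with Cauchy_converges_subseq[OF X] show ?thesis by (auto simp: convergent_def)
qed

text \<open>The second factor is complete because it is compact and not by its type class; hence
  \<open>prokhorov_sequential\<close> takes completeness as an assumption on Cauchy
  sequences.\<close>

lemma Cauchy_imp_convergent_prod:
  fixes X :: "nat \<Rightarrow> 'a::complete_space \<times> 'b::metric_space"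
  assumes "compact (UNIV :: 'b set)" and X: "Cauchy X"
  shows "convergent X"
proof -
  have "convergent (\<lambda>n. fst (X n))" by (intro Cauchy_convergent Cauchy_fst X)
  moreover have "convergent (\<lambda>n. snd (X n))" by (intro Cauchy_imp_convergent_compact[OF assms(1)] Cauchy_snd X)
  ultimately obtain a b where "(\<lambda>n. fst (X n)) \<longlonglongrightarrow> a" "(\<lambda>n. snd (X n)) \<longlonglongrightarrow> b"
    by (auto simp: convergent_def)
  then have "(\<lambda>n. (fst (X n), snd (X n))) \<longlonglongrightarrow> (a, b)" by (rule tendsto_Pair)
  then show ?thesis by (auto simp: convergent_def)
qed

lemma fst_borel_measurable [measurable]:
  "fst \<in> measurable borel (borel :: 'a::topological_space measure)"
  by (intro borel_measurable_continuous_onI continuous_intros)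

lemma Prob_marginal:
  assumes "m \<in> Prob"
  shows "distr m borel (fst :: 'a::topological_space \<times> 'b::topological_space \<Rightarrow> 'a) \<in> Prob"
proof -
  interpret prob_space m using assms by (simp add: Prob_def)
  have "fst \<in> measurable m (borel :: 'a measure)"
    using assms fst_borel_measurable by (simp add: Prob_def cong: measurable_cong_sets)
  then show ?thesis by (simp add: Prob_def prob_space_distr)
qed

lemma integral_marginal:
  fixes m :: "('a::topological_space \<times> 'b::topological_space) measure" and f :: "'a \<Rightarrow> real"
  assumes "m \<in> Prob" and "f \<in> borel_measurable borel"
  shows "integral\<^sup>L (distr m borel fst) f = (\<integral>p. f (fst p) \<partial>m)"
proof (rule integral_distr)
  show "fst \<in> measurable m (borel :: 'a measure)"
    using assms(1) fst_borel_measurable by (simp add: Prob_def cong: measurable_cong_sets)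
qed fact

text \<open>By the triangle inequality the \<open>d\<close>-ball around \<open>m\<close> meets the
  metric description of openness, so it is weakly open and the sequence eventually stays in
  it.\<close>

lemma compatible_metric_tendsto:
  assumes d: "compatible_metric d" and m: "m \<in> Prob" and lim: "limitin weak_top \<mu> m sequentially"
    and "e > 0"
  shows "\<forall>\<^sub>F n in sequentially. \<mu> n \<in> Prob \<and> d (\<mu> n) m < e"
proof -
  have metric: "d m1 m2 = d m2 m1" "d m1 m1 = 0" "d m1 m3 \<le> d m1 m2 + d m2 m3"
    if "m1 \<in> Prob" "m2 \<in> Prob" "m3 \<in> Prob" for m1 m2 m3
    using d that unfolding compatible_metric_def by blast+
  let ?U = "{m' \<in> Prob. d m m' < e}"
  have "openin weak_top ?U"
  proof -
    have "\<exists>\<epsilon>>0. \<forall>m'\<in>Prob. d m1 m' < \<epsilon> \<longrightarrow> m' \<in> ?U" if "m1 \<in> ?U" for m1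
      using that metric(3)[OF m, of m1] by (intro exI[of _ "e - d m m1"]) force
    then have "?U \<subseteq> Prob \<and> (\<forall>m1\<in>?U. \<exists>\<epsilon>>0. \<forall>m'\<in>Prob. d m1 m' < \<epsilon> \<longrightarrow> m' \<in> ?U)"
      by blast
    then show ?thesis
      using d[unfolded compatible_metric_def, THEN conjunct2, THEN conjunct2, THEN spec, of ?U] by (rule iffD2[rotated])
  qed
  moreover have "m \<in> ?U" using m metric(2)[of m m m] \<open>e > 0\<close> by simp
  ultimately have "\<forall>\<^sub>F n in sequentially. \<mu> n \<in> ?U" using lim by (auto simp: limitin_def)
  then show ?thesis by eventually_elim (use metric(1) m in auto)
qed

text \<open>Total boundedness of the second factor gives a finite \<open>r / 2\<close>-net
  \<open>K\<close>; the balls of radius \<open>r\<close> about \<open>S \<times> K\<close> contain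
  the whole strip over the \<open>r / 2\<close>-balls about \<open>S\<close>.\<close>

lemma tight_Times:
  fixes \<mu> :: "nat \<Rightarrow> ('a::metric_space \<times> 'b::metric_space) measure"
  assumes compact: "compact (UNIV :: 'b set)" and \<mu>: "\<And>n. \<mu> n \<in> Prob" and r: "r > 0"
    and S: "finite S" "\<forall>\<^sub>F n in sequentially. 1 - \<epsilon> \<le> measure (distr (\<mu> n) borel fst) (\<Union>x\<in>S. ball x (r / 2))"
  shows "\<exists>T. finite T \<and> (\<forall>\<^sub>F n in sequentially. 1 - \<epsilon> \<le> measure (\<mu> n) (\<Union>q\<in>T. ball q r))"
proof -
  obtain K :: "'b set" where K: "finite K" "UNIV \<subseteq> (\<Union>x\<in>K. ball x (r / 2))"
    using seq_compact_imp_totally_bounded[OF compact_imp_seq_compact[OF compact], rule_format, of "r / 2"] r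
    by auto
  have sub: "fst -` (\<Union>x\<in>S. ball x (r / 2)) \<subseteq> (\<Union>q\<in>S \<times> K. ball q r)"
  proof
    fix p :: "'a \<times> 'b" assume "p \<in> fst -` (\<Union>x\<in>S. ball x (r / 2))"
    then obtain x where x: "x \<in> S" "dist x (fst p) < r / 2" by auto
    obtain y where y: "y \<in> K" "dist y (snd p) < r / 2" using K(2) by (auto simp: subset_eq)
    show "p \<in> (\<Union>q\<in>S \<times> K. ball q r)"
      using x y dist_prod_le[of "(x, y)" p] by (intro UN_I[of "(x, y)"]) auto
  qed
  have le: "measure (distr (\<mu> n) borel fst) (\<Union>x\<in>S. ball x (r / 2)) \<le> measure (\<mu> n) (\<Union>q\<in>S \<times> K. ball q r)" for n
  proof -
    interpret prob_space "\<mu> n" using \<mu>[of n] by (simp add: Prob_def)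
    have sets: "events = sets borel" using \<mu>[of n] by (simp add: Prob_def)
    have "fst \<in> measurable (\<mu> n) (borel :: 'a measure)"
      using sets fst_borel_measurable by (simp cong: measurable_cong_sets)
    then have "measure (distr (\<mu> n) borel fst) (\<Union>x\<in>S. ball x (r / 2))
        = prob (fst -` (\<Union>x\<in>S. ball x (r / 2)) \<inter> space (\<mu> n))"
      by (rule measure_distr) (simp add: open_UN)
    also have "\<dots> \<le> prob (\<Union>q\<in>S \<times> K. ball q r)"
      using sub by (intro finite_measure_mono) (auto simp: sets open_UN)
    finally show ?thesis .
  qed
  from S(2) have "\<forall>\<^sub>F n in sequentially. 1 - \<epsilon> \<le> measure (\<mu> n) (\<Union>q\<in>S \<times> K. ball q r)"
    by (rule eventually_mono) (rule order_trans[OF _ le])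
  then show ?thesis
    using finite_cartesian_product[OF S(1) K(1)] by (intro exI[of _ "S \<times> K"] conjI)
qed

theorem theorem2p2:
  fixes F :: "('w::polish_space \<times> 'x::metric_space) measure \<Rightarrow> 'w \<Rightarrow> 'x \<Rightarrow> real"
    and C :: "'w \<Rightarrow> 'x set"
    and P :: "'o measure"
    and W :: "nat \<Rightarrow> 'o \<Rightarrow> 'w"
    and lam0 :: "'w measure"
    and xhat :: "nat \<Rightarrow> nat \<Rightarrow> (nat \<Rightarrow> 'w) \<Rightarrow> 'x"
    and d :: "('w \<times> 'x) measure \<Rightarrow> ('w \<times> 'x) measure \<Rightarrow> real"
  assumes X_compact: "compact (UNIV :: 'x set)"
    and C_nonempty: "\<And>w. C w \<noteq> {}"
    and C_closed: "\<And>w. closed (C w)"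
    and C_cont: "continuous_corr C"
    and F_bounded: "\<exists>B. \<forall>m\<in>Prob. \<forall>w x. \<bar>F m w x\<bar> \<le> B"
    and F_cont: "continuous_map (prod_topology weak_top euclidean) euclideanreal
                   (\<lambda>(m, p). F m (fst p) (snd p))"
    and nash_exists: "\<And>n w. \<exists>x. nash F C n w x"
    and P_prob: "prob_space P"
    and W_meas: "\<And>i. W i \<in> measurable P borel"
    and W_indep: "prob_space.indep_vars P (\<lambda>_. borel) W UNIV"
    and W_law: "\<And>i. distr P borel (W i) = lam0"
    and xhat_meas: "\<And>n i. i < n \<Longrightarrow> xhat n i \<in> measurable (PiM {..<n} (\<lambda>_. borel)) borel"
    and xhat_nash: "\<And>n w. w \<in> space (PiM {..<n} (\<lambda>_. (borel :: 'w measure))) \<Longrightarrow>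
                       nash F C n w (\<lambda>i. xhat n i w)"
    and d_compat: "compatible_metric d"
  shows "AE \<omega> in P.
           (\<lambda>n. INF m\<in>CN F C lam0.
                  ereal (d (empirical n (\<lambda>i. (W i \<omega>, xhat n i (restrict (\<lambda>k. W k \<omega>) {..<n})))) m))
           \<longlonglongrightarrow> 0"
proof -
  interpret P: prob_space P by (rule P_prob)
  obtain D :: "'w set" where D: "countable D" "\<And>X. open X \<Longrightarrow> X \<noteq> {} \<Longrightarrow> \<exists>d\<in>D. d \<in> X"
    by (rule countable_dense_setE) blast
  have D': "\<exists>y\<in>D. dist x y < r" if "r > 0" for x r
    using D(2)[of "ball x r"] that by auto
  obtain E :: "'x set" where E: "countable E" "\<And>x r. r > 0 \<Longrightarrow> \<exists>y\<in>E. dist x y < r"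
    by (rule countable_dense_of_compact[OF X_compact]) blast
  have DE: "countable (D \<times> E)" "\<And>p r. r > 0 \<Longrightarrow> \<exists>q\<in>D \<times> E. dist p q < r"
    using D(1) E(1) dense_Times[of D E, OF D' E(2)] by auto
  have "D \<noteq> {}" using D'[of 1] by force
  interpret dense_sequence "from_nat_into D"
    by unfold_locales (metis D' D(1) from_nat_into_surj)
  have lam0: "lam0 \<in> Prob"
    using P.prob_space_distr[OF W_meas[of 0]] unfolding W_law[of 0, symmetric] by (simp add: Prob_def)
  \<comment> \<open>\<open>c\<close> ranges over the countable type of bump parameters. All
    randomness enters here, through one null set; the remaining argument is deterministic.\<close>
  have "AE \<omega> in P. \<forall>c. (\<lambda>n. (\<Sum>i<n. bump (fst c) (snd c) (W i \<omega>)) / n) \<longlonglongrightarrow> integral\<^sup>L lam0 (bump (fst c) (snd c))"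
    unfolding AE_all_countable
    by (intro allI P.slln_bounded W_meas W_indep W_law bump_measurable bump_range)
  then show ?thesis
  proof eventually_elim
    case (elim \<omega>)
    define w where "w i = W i \<omega>" for i
    define x where "x n i = xhat n i (restrict w {..<n})" for n i
    define \<mu> where "\<mu> n = empirical n (\<lambda>i. (w i, x n i))" for n
    define h where "h n = (INF m\<in>CN F C lam0. ereal (d (\<mu> n) m))" for n
    have nash_x: "nash F C n w (x n)" for n
    proof -
      have "nash F C n (restrict w {..<n}) (x n)"
        using xhat_nash[of "restrict w {..<n}" n] by (simp add: x_def[abs_def] space_PiM)
      then show ?thesis by (rule nash_cong[rotated]) simp
    qed
    have \<mu>: "\<mu> n \<in> Prob" if "n > 0" for n
      unfolding \<mu>_def by (rule empirical_Prob[OF that])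
    have h_nonneg: "0 \<le> h n" if "n > 0" for n
      unfolding h_def using d_compat \<mu>[OF that]
      by (intro INF_greatest) (auto simp: CN_def compatible_metric_def)
    \<comment> \<open>Index 0 is excluded because the empirical measure of no players has mass
      0.\<close>
    have subseq: "\<exists>n. h (r n) < a" if r: "strict_mono r" "\<And>n. r n > 0" and a: "a > 0" for r :: "nat \<Rightarrow> nat" and a
    proof -
      have marginal: "(\<lambda>n. integral\<^sup>L (distr (\<mu> (r n)) borel fst) (bump l cs)) \<longlonglongrightarrow> integral\<^sup>L lam0 (bump l cs)" for l cs
      proof -
        have "integral\<^sup>L (distr (\<mu> (r n)) borel fst) (bump l cs) = (\<Sum>i<r n. bump l cs (w i)) / r n" for n
          by (subst integral_marginal[OF \<mu>[OF r(2)] bump_measurable])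
             (simp add: \<mu>_def integral_empirical)
        then show ?thesis
          using LIMSEQ_subseq_LIMSEQ[OF elim[rule_format, of "(l, cs)"] r(1)] by (simp add: w_def o_def)
      qed
      have "\<exists>T. finite T \<and> (\<forall>\<^sub>F n in sequentially. 1 - \<epsilon> \<le> measure (\<mu> (r n)) (\<Union>q\<in>T. ball q \<rho>))"
        if \<rho>: "\<rho> > 0" and \<epsilon>: "\<epsilon> > 0" for \<rho> \<epsilon>
      proof -
        obtain S where S: "finite S" "\<forall>\<^sub>F n in sequentially.
            1 - \<epsilon> \<le> measure (distr (\<mu> (r n)) borel fst) (\<Union>x\<in>S. ball x (\<rho> / 2))"
          using tight_bump[OF lam0 Prob_marginal[OF \<mu>[OF r(2)]] marginal half_gt_zero[OF \<rho>] \<epsilon>] by blast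
        show ?thesis by (rule tight_Times[OF X_compact \<mu>[OF r(2)] \<rho> S])
      qed
      from prokhorov_sequential[OF Cauchy_imp_convergent_prod[OF X_compact] DE \<mu>[OF r(2)] this]
      obtain s m where s: "strict_mono s" and m: "m \<in> Prob"
        and lim: "\<And>f :: 'w \<times> 'x \<Rightarrow> real. continuous_on UNIV f \<Longrightarrow> bounded (range f) \<Longrightarrow>
            (\<lambda>n. integral\<^sup>L (\<mu> (r (s n))) f) \<longlonglongrightarrow> integral\<^sup>L m f" by blast
      have "distr m borel fst = lam0"
      proof (rule measure_eqI_bump[OF Prob_marginal[OF m] lam0])
        fix l cs
        have "(\<lambda>n. \<integral>p. bump l cs (fst p) \<partial>\<mu> (r (s n))) \<longlonglongrightarrow> (\<integral>p. bump l cs (fst p) \<partial>m)"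
        proof (rule lim)
          show "continuous_on UNIV (\<lambda>p. bump l cs (fst p))"
            by (rule continuous_on_compose2[OF bump_continuous]) (auto intro: continuous_intros)
          show "bounded (range (\<lambda>p. bump l cs (fst p)))"
            by (rule bounded_subset[OF bump_bounded[of l cs]]) auto
        qed
        moreover have "(\<lambda>n. \<integral>p. bump l cs (fst p) \<partial>\<mu> (r (s n))) \<longlonglongrightarrow> integral\<^sup>L lam0 (bump l cs)"
          using LIMSEQ_subseq_LIMSEQ[OF marginal s]
          by (simp add: o_def integral_marginal[OF \<mu>[OF r(2)] bump_measurable])
        ultimately show "integral\<^sup>L (distr m borel fst) (bump l cs) = integral\<^sup>L lam0 (bump l cs)"
          unfolding integral_marginal[OF m bump_measurable] by (rule LIMSEQ_unique)
      qed
      moreover have "AE p in m. snd p \<in> C (fst p) \<and> F m (fst p) (snd p) = (INF y\<in>C (fst p). F m (fst p) y)"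
      proof (rule nash_limit_CN[OF DE C_cont F_bounded F_cont])
        show "r (s n) > 0" for n by (rule r(2))
        show "filterlim (\<lambda>n. r (s n)) at_top sequentially"
          using filterlim_subseq[OF strict_mono_o[OF r(1) s]] by (simp add: o_def)
        show "nash F C (r (s n)) w (x (r (s n)))" for n by (rule nash_x)
      qed (use m lim in \<open>auto simp: \<mu>_def\<close>)
      ultimately have CN: "m \<in> CN F C lam0" using m by (simp add: CN_def)
      \<comment> \<open>\<open>a\<close> may be infinite, hence the real \<open>b\<close> in
        between; as \<open>m\<close> belongs to \<open>CN F C lam0\<close>, the infimum is bounded
        by a genuine distance.\<close>
      obtain b where b: "ereal b < a" "b > 0"
        using ereal_dense2[OF a] by auto
      have "limitin weak_top (\<lambda>n. \<mu> (r (s n))) m sequentially"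
        by (rule limitin_weak_topI[OF m \<mu>[OF r(2)] lim])
      from compatible_metric_tendsto[OF d_compat m this b(2)] obtain n where "d (\<mu> (r (s n))) m < b"
        by (auto simp: eventually_sequentially)
      moreover have "h (r (s n)) \<le> ereal (d (\<mu> (r (s n))) m)"
        unfolding h_def by (rule INF_lower[OF CN])
      ultimately have "h (r (s n)) < a" using b(1) by (metis ereal_less_eq(3) le_less_trans less_imp_le)
      then show ?thesis by blast
    qed
    have "h \<longlonglongrightarrow> 0"
    proof (rule order_tendstoI)
      fix a :: ereal assume "a < 0"
      then show "\<forall>\<^sub>F n in sequentially. a < h n"
        using h_nonneg by (intro eventually_sequentiallyI[of 1]) (metis One_nat_def Suc_le_lessD less_le_trans)
    next
      fix a :: ereal assume a: "0 < a"
      show "\<forall>\<^sub>F n in sequentially. h n < a"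
      proof (rule ccontr)
        assume "\<not> (\<forall>\<^sub>F n in sequentially. h n < a)"
        then have "infinite {n. \<not> h n < a}"
          by (simp add: eventually_cofinite cofinite_eq_sequentially[symmetric])
        then have "infinite ({n. \<not> h n < a} - {0})" by simp
        then obtain r :: "nat \<Rightarrow> nat" where r: "strict_mono r" "\<And>n. r n \<in> {n. \<not> h n < a} - {0}"
          using infinite_enumerate by blast
        have "r n > 0" for n using r(2)[of n] by simp
        then obtain n where "h (r n) < a" using subseq[OF r(1) _ a] by auto
        with r(2)[of n] show False by simp
      qed
    qed
    then show ?case by (simp add: h_def[abs_def] \<mu>_def x_def w_def[abs_def])
  qed
qed

end
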